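(* Let $G$ be an infinite (discrete) FC group such that for every integer $n$ there are only finitely many conjugacy classes $C$ of $G$ with $|C|=n$. Then $Z\ell^1(G)$ is not amenable as a Banach algebra.
   Context: A discrete group $G$ is an FC (finite conjugacy) group if every conjugacy class of $G$ is finite. $Z\ell^1(G)$ is the center of the group algebra $\ell^1(G)$ (with convolution). A Banach algebra $A$ is amenable if every bounded derivation from $A$ into a dual Banach $A$-bimodule is inner. *)

theory Defs
  imports "HOL-Analysis.Analysis" "HOL-Algebra.Module"
begin

section \<open>Banach spaces and Banach algebras over the complex numbers\<close>

text \<open>
  Amenability quantifies over Banach spaces, so these are carrier-based structures. As in
  HOL-Algebra, modules extend the ring record; for a mere Banach space the fields
  \<^const>\<open>mult\<close> and \<^const>\<open>one\<close> are never used.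
\<close>

record 'v cnormed = "(complex, 'v) module" +
  vnorm :: "'v \<Rightarrow> real"

definition complex_space :: "complex cnormed" where
  "complex_space = \<lparr>carrier = UNIV, monoid.mult = (*), one = 1, zero = 0, add = (+),
                     smult = (*), vnorm = cmod\<rparr>"

locale banach_space = module complex_space V for V :: "'v cnormed" (structure) +
  assumes vnorm_nonneg: "x \<in> carrier V \<Longrightarrow> 0 \<le> vnorm V x"
    and vnorm_eq_zero: "x \<in> carrier V \<Longrightarrow> vnorm V x = 0 \<longleftrightarrow> x = \<zero>"
    and vnorm_triangle: "x \<in> carrier V \<Longrightarrow> y \<in> carrier V \<Longrightarrow> vnorm V (x \<oplus> y) \<le> vnorm V x + vnorm V y"
    and vnorm_smult: "x \<in> carrier V \<Longrightarrow> vnorm V (c \<odot> x) = cmod c * vnorm V x"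
    and complete:
      "range s \<subseteq> carrier V \<Longrightarrow>
       (\<forall>e>0. \<exists>N. \<forall>m\<ge>N. \<forall>n\<ge>N. vnorm V (s m \<ominus> s n) < e) \<Longrightarrow>
       \<exists>x\<in>carrier V. (\<lambda>n::nat. vnorm V (s n \<ominus> x)) \<longlonglongrightarrow> 0"

text \<open>No unit is required.\<close>

locale banach_algebra = banach_space A for A :: "'a cnormed" (structure) +
  assumes mult_closed: "a \<in> carrier A \<Longrightarrow> b \<in> carrier A \<Longrightarrow> a \<otimes> b \<in> carrier A"
    and mult_assoc: "a \<in> carrier A \<Longrightarrow> b \<in> carrier A \<Longrightarrow> c \<in> carrier A \<Longrightarrow>
      (a \<otimes> b) \<otimes> c = a \<otimes> (b \<otimes> c)"
    and mult_distrib_left: "a \<in> carrier A \<Longrightarrow> b \<in> carrier A \<Longrightarrow> c \<in> carrier A \<Longrightarrow>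
      a \<otimes> (b \<oplus> c) = (a \<otimes> b) \<oplus> (a \<otimes> c)"
    and mult_distrib_right: "a \<in> carrier A \<Longrightarrow> b \<in> carrier A \<Longrightarrow> c \<in> carrier A \<Longrightarrow>
      (a \<oplus> b) \<otimes> c = (a \<otimes> c) \<oplus> (b \<otimes> c)"
    and smult_mult_left: "a \<in> carrier A \<Longrightarrow> b \<in> carrier A \<Longrightarrow> (z \<odot> a) \<otimes> b = z \<odot> (a \<otimes> b)"
    and smult_mult_right: "a \<in> carrier A \<Longrightarrow> b \<in> carrier A \<Longrightarrow> a \<otimes> (z \<odot> b) = z \<odot> (a \<otimes> b)"
    and vnorm_mult: "a \<in> carrier A \<Longrightarrow> b \<in> carrier A \<Longrightarrow> vnorm A (a \<otimes> b) \<le> vnorm A a * vnorm A b"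

definition algebra_center :: "'a cnormed \<Rightarrow> 'a cnormed" where
  "algebra_center A =
     A\<lparr>carrier := {z \<in> carrier A. \<forall>a\<in>carrier A. z \<otimes>\<^bsub>A\<^esub> a = a \<otimes>\<^bsub>A\<^esub> z}\<rparr>"

definition bounded_linear_map :: "'v cnormed \<Rightarrow> 'w cnormed \<Rightarrow> ('v \<Rightarrow> 'w) \<Rightarrow> bool" where
  "bounded_linear_map V W T \<longleftrightarrow>
     (\<forall>x\<in>carrier V. T x \<in> carrier W) \<and>
     (\<forall>x\<in>carrier V. \<forall>y\<in>carrier V. T (x \<oplus>\<^bsub>V\<^esub> y) = T x \<oplus>\<^bsub>W\<^esub> T y) \<and>
     (\<forall>c. \<forall>x\<in>carrier V. T (c \<odot>\<^bsub>V\<^esub> x) = c \<odot>\<^bsub>W\<^esub> T x) \<and>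
     (\<exists>K. \<forall>x\<in>carrier V. vnorm W (T x) \<le> K * vnorm V x)"


section \<open>Banach bimodules, derivations, amenability\<close>

locale banach_bimodule = A?: banach_algebra A + E?: banach_space E
  for A :: "'a cnormed" and E :: "'e cnormed"
    and l :: "'a \<Rightarrow> 'e \<Rightarrow> 'e" and r :: "'e \<Rightarrow> 'a \<Rightarrow> 'e" +
  assumes l_closed: "a \<in> carrier A \<Longrightarrow> x \<in> carrier E \<Longrightarrow> l a x \<in> carrier E"
    and r_closed: "a \<in> carrier A \<Longrightarrow> x \<in> carrier E \<Longrightarrow> r x a \<in> carrier E"
    and l_add_left: "a \<in> carrier A \<Longrightarrow> b \<in> carrier A \<Longrightarrow> x \<in> carrier E \<Longrightarrow>
      l (a \<oplus>\<^bsub>A\<^esub> b) x = l a x \<oplus>\<^bsub>E\<^esub> l b x"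
    and l_add_right: "a \<in> carrier A \<Longrightarrow> x \<in> carrier E \<Longrightarrow> y \<in> carrier E \<Longrightarrow>
      l a (x \<oplus>\<^bsub>E\<^esub> y) = l a x \<oplus>\<^bsub>E\<^esub> l a y"
    and l_smult_left: "a \<in> carrier A \<Longrightarrow> x \<in> carrier E \<Longrightarrow> l (c \<odot>\<^bsub>A\<^esub> a) x = c \<odot>\<^bsub>E\<^esub> l a x"
    and l_smult_right: "a \<in> carrier A \<Longrightarrow> x \<in> carrier E \<Longrightarrow> l a (c \<odot>\<^bsub>E\<^esub> x) = c \<odot>\<^bsub>E\<^esub> l a x"
    and r_add_left: "a \<in> carrier A \<Longrightarrow> x \<in> carrier E \<Longrightarrow> y \<in> carrier E \<Longrightarrow>
      r (x \<oplus>\<^bsub>E\<^esub> y) a = r x a \<oplus>\<^bsub>E\<^esub> r y a"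
    and r_add_right: "a \<in> carrier A \<Longrightarrow> b \<in> carrier A \<Longrightarrow> x \<in> carrier E \<Longrightarrow>
      r x (a \<oplus>\<^bsub>A\<^esub> b) = r x a \<oplus>\<^bsub>E\<^esub> r x b"
    and r_smult_left: "a \<in> carrier A \<Longrightarrow> x \<in> carrier E \<Longrightarrow> r (c \<odot>\<^bsub>E\<^esub> x) a = c \<odot>\<^bsub>E\<^esub> r x a"
    and r_smult_right: "a \<in> carrier A \<Longrightarrow> x \<in> carrier E \<Longrightarrow> r x (c \<odot>\<^bsub>A\<^esub> a) = c \<odot>\<^bsub>E\<^esub> r x a"
    and l_assoc: "a \<in> carrier A \<Longrightarrow> b \<in> carrier A \<Longrightarrow> x \<in> carrier E \<Longrightarrow>
      l (a \<otimes>\<^bsub>A\<^esub> b) x = l a (l b x)"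
    and r_assoc: "a \<in> carrier A \<Longrightarrow> b \<in> carrier A \<Longrightarrow> x \<in> carrier E \<Longrightarrow>
      r x (a \<otimes>\<^bsub>A\<^esub> b) = r (r x a) b"
    and l_r_assoc: "a \<in> carrier A \<Longrightarrow> b \<in> carrier A \<Longrightarrow> x \<in> carrier E \<Longrightarrow>
      r (l a x) b = l a (r x b)"
    and l_bounded: "\<exists>K. \<forall>a\<in>carrier A. \<forall>x\<in>carrier E. vnorm E (l a x) \<le> K * vnorm A a * vnorm E x"
    and r_bounded: "\<exists>K. \<forall>a\<in>carrier A. \<forall>x\<in>carrier E. vnorm E (r x a) \<le> K * vnorm A a * vnorm E x"

text \<open>Functionals are normalised to vanish outside the carrier, so that equality of
  functionals is equality of functions.\<close>

definition dual_space :: "'e cnormed \<Rightarrow> ('e \<Rightarrow> complex) cnormed" where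
  "dual_space E =
     \<lparr>carrier = {\<phi>. bounded_linear_map E complex_space \<phi> \<and> (\<forall>x. x \<notin> carrier E \<longrightarrow> \<phi> x = 0)},
      monoid.mult = undefined, one = undefined,
      zero = (\<lambda>x. 0), add = (\<lambda>\<phi> \<psi> x. \<phi> x + \<psi> x),
      smult = (\<lambda>c \<phi> x. c * \<phi> x),
      vnorm = (\<lambda>\<phi>. SUP x\<in>{x \<in> carrier E. vnorm E x \<le> 1}. cmod (\<phi> x))\<rparr>"

text \<open>The dual actions \<open>(a \<cdot> \<phi>)(x) = \<phi>(x \<cdot> a)\<close> and \<open>(\<phi> \<cdot> a)(x) = \<phi>(a \<cdot> x)\<close>: the left action on
  the dual comes from the right action on \<open>E\<close>, and vice versa.\<close>

definition dual_left :: "'e cnormed \<Rightarrow> ('e \<Rightarrow> 'a \<Rightarrow> 'e) \<Rightarrow> 'a \<Rightarrow> ('e \<Rightarrow> complex) \<Rightarrow> ('e \<Rightarrow> complex)" where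
  "dual_left E r a \<phi> = (\<lambda>x. if x \<in> carrier E then \<phi> (r x a) else 0)"

definition dual_right :: "'e cnormed \<Rightarrow> ('a \<Rightarrow> 'e \<Rightarrow> 'e) \<Rightarrow> ('e \<Rightarrow> complex) \<Rightarrow> 'a \<Rightarrow> ('e \<Rightarrow> complex)" where
  "dual_right E l \<phi> a = (\<lambda>x. if x \<in> carrier E then \<phi> (l a x) else 0)"

definition bounded_derivation ::
  "'a cnormed \<Rightarrow> 'x cnormed \<Rightarrow> ('a \<Rightarrow> 'x \<Rightarrow> 'x) \<Rightarrow> ('x \<Rightarrow> 'a \<Rightarrow> 'x) \<Rightarrow> ('a \<Rightarrow> 'x) \<Rightarrow> bool" where
  "bounded_derivation A X l r D \<longleftrightarrow>
     bounded_linear_map A X D \<and>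
     (\<forall>a\<in>carrier A. \<forall>b\<in>carrier A. D (a \<otimes>\<^bsub>A\<^esub> b) = l a (D b) \<oplus>\<^bsub>X\<^esub> r (D a) b)"

definition inner_derivation ::
  "'a cnormed \<Rightarrow> 'x cnormed \<Rightarrow> ('a \<Rightarrow> 'x \<Rightarrow> 'x) \<Rightarrow> ('x \<Rightarrow> 'a \<Rightarrow> 'x) \<Rightarrow> ('a \<Rightarrow> 'x) \<Rightarrow> bool" where
  "inner_derivation A X l r D \<longleftrightarrow>
     (\<exists>x\<in>carrier X. \<forall>a\<in>carrier A. D a = l a x \<ominus>\<^bsub>X\<^esub> r x a)"

text \<open>
  HOL cannot quantify over all types inside a formula, so the bimodule \<open>E\<close> ranges over all
  Banach \<open>A\<close>-bimodules whose carrier is a set of elements of \<open>'a \<times> 'a \<Rightarrow> complex\<close>, with arbitrary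
  operations and norm. This loses no generality: if a derivation into the dual of some Banach
  bimodule of any size is not inner, then, by weak* compactness, neither is its
  restriction to some closed sub-bimodule generated by countably many elements. Such a
  sub-bimodule has at most \<open>|A|\<^sup>\<aleph>\<close> elements with \<open>\<aleph> = |nat|\<close> (\<open>A\<close> being nonzero), hence is isomorphic to one
  carried by this type. The type is also large enough for the bounded bilinear forms on \<open>A\<close>,
  i.e. for the dual of the projective tensor square of \<open>A\<close>.
\<close>

definition amenable :: "'a cnormed \<Rightarrow> bool" where
  "amenable A \<longleftrightarrow>
     (\<forall>(E :: ('a \<times> 'a \<Rightarrow> complex) cnormed) l r D.
        banach_bimodule A E l r \<longrightarrow>
        bounded_derivation A (dual_space E) (dual_left E r) (dual_right E l) D \<longrightarrow>
        inner_derivation A (dual_space E) (dual_left E r) (dual_right E l) D)"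


section \<open>The group algebra of a discrete group and conjugacy classes\<close>

definition l1_algebra :: "('g, 'm) monoid_scheme \<Rightarrow> ('g \<Rightarrow> complex) cnormed" where
  "l1_algebra G =
     \<lparr>carrier = {f. (\<forall>x. x \<notin> carrier G \<longrightarrow> f x = 0) \<and> (\<lambda>x. cmod (f x)) summable_on carrier G},
      monoid.mult = (\<lambda>f g x. if x \<in> carrier G
        then (\<Sum>\<^sub>\<infinity>y\<in>carrier G. f y * g (inv\<^bsub>G\<^esub> y \<otimes>\<^bsub>G\<^esub> x)) else 0),
      one = (\<lambda>x. if x = \<one>\<^bsub>G\<^esub> then 1 else 0),
      zero = (\<lambda>x. 0), add = (\<lambda>f g x. f x + g x),
      smult = (\<lambda>c f x. c * f x),
      vnorm = (\<lambda>f. \<Sum>\<^sub>\<infinity>x\<in>carrier G. cmod (f x))\<rparr>"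

definition conj_class :: "('g, 'm) monoid_scheme \<Rightarrow> 'g \<Rightarrow> 'g set" where
  "conj_class G x = (\<lambda>g. g \<otimes>\<^bsub>G\<^esub> x \<otimes>\<^bsub>G\<^esub> inv\<^bsub>G\<^esub> g) ` carrier G"

definition conj_classes :: "('g, 'm) monoid_scheme \<Rightarrow> 'g set set" where
  "conj_classes G = conj_class G ` carrier G"

definition FC_group :: "('g, 'm) monoid_scheme \<Rightarrow> bool" where
  "FC_group G \<longleftrightarrow> group G \<and> (\<forall>C\<in>conj_classes G. finite C)"

end

theory Submission
  imports Defs
begin

text \<open>
  Let \<open>A\<close> be the centre of \<open>\<ell>\<^sup>1(G)\<close>, the algebra of integrable class functions. A class function \<open>b\<close>
  satisfies \<open>|b(w)| \<le> \<parallel>b\<parallel> / |C|\<close> for \<open>w\<close> in a class \<open>C\<close>, and by hypothesis all but finitely many \<open>w\<close> lie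
  in large classes. Hence each form \<open>(a, b) \<mapsto> (a * b)(x)\<close> on \<open>A \<times> A\<close> belongs to the closed span \<open>E\<close> of the
  forms \<open>(a, b) \<mapsto> a(x) b(y)\<close>, which plays the role of \<open>c\<^sub>0\<close>. So \<open>E\<close> is a bimodule under
  \<open>(\<Psi> \<cdot> c)(a, b) = \<Psi>(c a, b)\<close> and \<open>(c \<cdot> \<Psi>)(a, b) = \<Psi>(a, b c) - \<Psi>(a b, c)\<close>, with the derivation
  \<open>D(c)(\<Psi>) = \<Psi>(1, c)\<close> into its dual. If a functional \<open>m\<close> on \<open>E\<close> makes \<open>D\<close> inner, then \<open>m\<close> is a diagonal:
  \<open>m((a, b) \<mapsto> (a b)(x)) = 1(x)\<close>, and \<open>m\<close> does not distinguish \<open>\<Psi>(c a, b)\<close> from \<open>\<Psi>(a, b c)\<close>.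
  Moreover \<open>m\<close> is given by an absolutely summable kernel \<open>M\<close> on \<open>G \<times> G\<close>. By the first property the
  total mass of \<open>M\<close> is \<open>1\<close>; by the second, applied to indicators \<open>c\<close> of ever larger classes, all
  its column sums are \<open>0\<close>.
\<close>

section \<open>Banach spaces of functions\<close>

lemma complex_space_simps [simp]:
  "carrier complex_space = UNIV" "x \<otimes>\<^bsub>complex_space\<^esub> y = x * y" "\<one>\<^bsub>complex_space\<^esub> = 1"
  "\<zero>\<^bsub>complex_space\<^esub> = 0" "x \<oplus>\<^bsub>complex_space\<^esub> y = x + y"
  "c \<odot>\<^bsub>complex_space\<^esub> x = c * x" "vnorm complex_space = cmod"
  by (simp_all add: complex_space_def)

lemma cring_complex_space: "cring complex_space"
proof (rule cringI)
  show "abelian_group complex_space"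
    by (rule abelian_groupI) (auto simp: algebra_simps intro: exI[of _ "- x" for x])
  show "comm_monoid complex_space"
    by unfold_locales auto
qed (auto simp: algebra_simps)

text \<open>The centre, the spaces of forms and the dual spaces all have these operations, so the
  module axioms and the formula for subtraction are derived once. The fields \<open>mult\<close> and
  \<open>one\<close> stay unconstrained, which lets the centre keep its convolution.\<close>

definition pointwise_space :: "('x \<Rightarrow> complex) cnormed \<Rightarrow> bool" where
  "pointwise_space V \<longleftrightarrow>
     zero V = (\<lambda>x. 0) \<and> add V = (\<lambda>f g x. f x + g x) \<and> smult V = (\<lambda>c f x. c * f x) \<and>
     (\<lambda>x. 0) \<in> carrier V \<and>
     (\<forall>f\<in>carrier V. \<forall>g\<in>carrier V. (\<lambda>x. f x + g x) \<in> carrier V) \<and>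
     (\<forall>c. \<forall>f\<in>carrier V. (\<lambda>x. c * f x) \<in> carrier V)"

lemma pointwise_spaceD:
  assumes "pointwise_space V"
  shows "\<zero>\<^bsub>V\<^esub> = (\<lambda>x. 0)" "f \<oplus>\<^bsub>V\<^esub> g = (\<lambda>x. f x + g x)" "c \<odot>\<^bsub>V\<^esub> f = (\<lambda>x. c * f x)"
    "(\<lambda>x. 0) \<in> carrier V"
    "f \<in> carrier V \<Longrightarrow> g \<in> carrier V \<Longrightarrow> (\<lambda>x. f x + g x) \<in> carrier V"
    "f \<in> carrier V \<Longrightarrow> (\<lambda>x. c * f x) \<in> carrier V"
  using assms by (auto simp: pointwise_space_def)

lemma pointwise_space_module:
  assumes "pointwise_space V"
  shows "module complex_space V"
proof (rule moduleI)
  note V = pointwise_spaceD[OF assms]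
  show "abelian_group V"
  proof (rule abelian_groupI)
    fix f assume f: "f \<in> carrier V"
    show "\<exists>y\<in>carrier V. y \<oplus>\<^bsub>V\<^esub> f = \<zero>\<^bsub>V\<^esub>"
      by (rule bexI[OF _ V(6)[OF f, of "-1"]]) (simp add: V(1-3))
  qed (auto simp: V algebra_simps)
qed (auto simp: pointwise_spaceD[OF assms] cring_complex_space algebra_simps)

lemma pointwise_space_minus:
  assumes "pointwise_space V" "f \<in> carrier V" "g \<in> carrier V"
  shows "f \<ominus>\<^bsub>V\<^esub> g = (\<lambda>x. f x - g x)"
proof -
  note V = pointwise_spaceD[OF assms(1)]
  interpret module complex_space V
    using assms(1) by (rule pointwise_space_module)
  have "\<ominus>\<^bsub>V\<^esub> g = (\<lambda>x. - g x)"
    by (rule minus_equality) (use V(6)[OF assms(3), of "-1"] assms in \<open>auto simp: V(1-3)\<close>)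
  then show ?thesis
    by (simp add: a_minus_def V(2))
qed

lemma pointwise_space_diff_closed:
  assumes "pointwise_space V" "f \<in> carrier V" "g \<in> carrier V"
  shows "(\<lambda>x. f x - g x) \<in> carrier V"
  using pointwise_spaceD(5)[OF assms(1,2) pointwise_spaceD(6)[OF assms(1,3), of "-1"]] by simp

text \<open>Completeness comes from pointwise limits: on the ambient set \<open>T\<close> the norm is lower
  semicontinuous for pointwise convergence, and the carrier is norm-closed in \<open>T\<close>.\<close>

lemma pointwise_space_banach:
  fixes V :: "('x \<Rightarrow> complex) cnormed"
  assumes V: "pointwise_space V"
    and sub: "carrier V \<subseteq> T"
    and nonneg: "\<And>f. f \<in> carrier V \<Longrightarrow> 0 \<le> vnorm V f"
    and triangle: "\<And>f g. f \<in> carrier V \<Longrightarrow> g \<in> carrier V \<Longrightarrow>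
      vnorm V (\<lambda>x. f x + g x) \<le> vnorm V f + vnorm V g"
    and scale: "\<And>c f. f \<in> carrier V \<Longrightarrow> vnorm V (\<lambda>x. c * f x) = cmod c * vnorm V f"
    and eval: "\<And>x. \<exists>k. \<forall>f\<in>carrier V. cmod (f x) \<le> k * vnorm V f"
    and lsc: "\<And>s f K. (\<And>n::nat. s n \<in> T) \<Longrightarrow> (\<And>n. vnorm V (s n) \<le> K) \<Longrightarrow>
      (\<And>x. (\<lambda>n. s n x) \<longlonglongrightarrow> f x) \<Longrightarrow> f \<in> T \<and> vnorm V f \<le> K"
    and closed: "\<And>f. f \<in> T \<Longrightarrow>
      (\<And>e. e > 0 \<Longrightarrow> \<exists>g\<in>carrier V. vnorm V (\<lambda>x. f x - g x) \<le> e) \<Longrightarrow> f \<in> carrier V"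
  shows "banach_space V"
proof -
  note V' = pointwise_spaceD[OF V]
  note minus = pointwise_space_minus[OF V]
  interpret module complex_space V
    using V by (rule pointwise_space_module)
  show ?thesis
  proof (unfold_locales, goal_cases)
    case (1 f) then show ?case by (rule nonneg)
  next
    case (2 f)
    have "vnorm V (\<lambda>x. 0) = 0"
      using scale[OF V'(4), of 0] by simp
    moreover have "f = (\<lambda>x. 0)" if "vnorm V f = 0"
    proof
      fix x
      obtain k where "cmod (f x) \<le> k * vnorm V f"
        using eval[of x] 2 by blast
      then show "f x = 0" using that by simp
    qed
    ultimately show ?case by (auto simp: V')
  next
    case (3 f g) then show ?case using triangle by (simp add: V')
  next
    case (4 f c) then show ?case using scale by (simp add: V')
  next
    case (5 s)
    then have s: "s n \<in> carrier V" for n by auto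
    have cauchy: "\<exists>N. \<forall>m\<ge>N. \<forall>n\<ge>N. vnorm V (\<lambda>x. s m x - s n x) < e" if "e > 0" for e
      using 5(2) that by (simp add: minus s)
    have "Cauchy (\<lambda>n. s n x)" for x
    proof -
      obtain k where k: "\<And>f. f \<in> carrier V \<Longrightarrow> cmod (f x) \<le> k * vnorm V f"
        using eval[of x] by blast
      show ?thesis
      proof (rule CauchyI)
        fix e :: real assume e: "e > 0"
        \<comment> \<open>The constant \<open>k\<close> may be zero or negative;
          \<open>\<bar>k\<bar> + 1\<close> is positive and dominates it.\<close>
        have e': "e / (\<bar>k\<bar> + 1) > 0" using e by simp
        obtain N where N: "\<And>m n. m \<ge> N \<Longrightarrow> n \<ge> N \<Longrightarrow>
            vnorm V (\<lambda>x. s m x - s n x) < e / (\<bar>k\<bar> + 1)"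
          using cauchy[OF e'] by blast
        have "cmod (s m x - s n x) < e" if "m \<ge> N" "n \<ge> N" for m n
        proof -
          let ?d = "\<lambda>x. s m x - s n x"
          have d: "?d \<in> carrier V" by (rule pointwise_space_diff_closed[OF V s s])
          have "cmod (?d x) \<le> k * vnorm V ?d" by (rule k[OF d])
          also have "\<dots> \<le> (\<bar>k\<bar> + 1) * vnorm V ?d"
            by (rule mult_right_mono) (use nonneg[OF d] in auto)
          also have "\<dots> < e"
            using N[OF that] by (simp add: field_simps)
          finally show ?thesis .
        qed
        then show "\<exists>N. \<forall>m\<ge>N. \<forall>n\<ge>N. cmod (s m x - s n x) < e" by blast
      qed
    qed
    then have "\<exists>l. (\<lambda>n. s n x) \<longlonglongrightarrow> l" for x
      by (simp add: Cauchy_convergent_iff convergent_def)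
    then obtain f where f: "\<And>x. (\<lambda>n. s n x) \<longlonglongrightarrow> f x" by metis
    have fT: "f \<in> T"
    proof -
      obtain N where N: "\<And>m n. m \<ge> N \<Longrightarrow> n \<ge> N \<Longrightarrow> vnorm V (\<lambda>x. s m x - s n x) < 1"
        using cauchy[of 1] by auto
      \<comment> \<open>Dropping the first \<open>N\<close> terms gives the Cauchy sequence an
        explicit norm bound, as lower semicontinuity on \<open>T\<close> requires.\<close>
      have "vnorm V (s (n + N)) \<le> 1 + vnorm V (s N)" for n
        using triangle[OF pointwise_space_diff_closed[OF V s s] s, of "n + N" N N] N[of "n + N" N]
        by simp
      then show ?thesis
        using lsc[of "\<lambda>n. s (n + N)" "1 + vnorm V (s N)" f] s sub LIMSEQ_ignore_initial_segment[OF f]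
        by blast
    qed
    have approx: "\<exists>N. \<forall>n\<ge>N. vnorm V (\<lambda>x. f x - s n x) \<le> e" if "e > 0" for e
    proof -
      obtain N where N: "\<And>m n. m \<ge> N \<Longrightarrow> n \<ge> N \<Longrightarrow> vnorm V (\<lambda>x. s m x - s n x) < e"
        using cauchy[OF \<open>e > 0\<close>] by blast
      \<comment> \<open>With \<open>n\<close> fixed, the differences \<open>s (m + N) - s n\<close>
        converge pointwise to \<open>f - s n\<close>, so lower semicontinuity carries the Cauchy
        estimate to the limit in \<open>m\<close>.\<close>
      have "vnorm V (\<lambda>x. f x - s n x) \<le> e" if "n \<ge> N" for n
      proof (rule conjunct2[OF lsc])
        show "(\<lambda>x. s (m + N) x - s n x) \<in> T" for m
          using pointwise_space_diff_closed[OF V s s] sub by blast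
        show "vnorm V (\<lambda>x. s (m + N) x - s n x) \<le> e" for m
          using N[of "m + N" n] that by simp
        show "(\<lambda>m. s (m + N) x - s n x) \<longlonglongrightarrow> f x - s n x" for x
          by (rule tendsto_diff[OF LIMSEQ_ignore_initial_segment[OF f] tendsto_const])
      qed
      then show ?thesis by blast
    qed
    have fV: "f \<in> carrier V"
      by (rule closed[OF fT]) (use approx s in blast)
    have "(\<lambda>n. vnorm V (s n \<ominus>\<^bsub>V\<^esub> f)) \<longlonglongrightarrow> 0"
    proof (rule LIMSEQ_I)
      fix e :: real assume "e > 0"
      then obtain N where N: "\<And>n. n \<ge> N \<Longrightarrow> vnorm V (\<lambda>x. f x - s n x) \<le> e / 2"
        using approx[of "e / 2"] by auto
      have "norm (vnorm V (s n \<ominus>\<^bsub>V\<^esub> f) - 0) < e" if "n \<ge> N" for n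
      proof -
        note d = pointwise_space_diff_closed[OF V fV s, of n]
        have "vnorm V (\<lambda>x. s n x - f x) = vnorm V (\<lambda>x. f x - s n x)"
          using scale[OF d, of "-1"] by (simp add: algebra_simps)
        then show ?thesis
          using N[OF that] nonneg[OF d] \<open>e > 0\<close> by (simp add: minus[OF s fV])
      qed
      then show "\<exists>N. \<forall>n\<ge>N. norm (vnorm V (s n \<ominus>\<^bsub>V\<^esub> f) - 0) < e" by blast
    qed
    with fV show ?case by blast
  qed
qed

section \<open>Bounded bilinear forms on a Banach algebra\<close>

text \<open>Extension by zero makes equality of forms equality of functions, in line with the
  normalisation in \<open>dual_space\<close>.\<close>

definition form_of :: "'a cnormed \<Rightarrow> ('a \<Rightarrow> 'a \<Rightarrow> complex) \<Rightarrow> 'a \<times> 'a \<Rightarrow> complex" where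
  "form_of A F = (\<lambda>(a, b). if a \<in> carrier A \<and> b \<in> carrier A then F a b else 0)"

definition form_bound :: "'a cnormed \<Rightarrow> ('a \<times> 'a \<Rightarrow> complex) \<Rightarrow> real \<Rightarrow> bool" where
  "form_bound A \<Psi> K \<longleftrightarrow>
     (\<forall>a\<in>carrier A. \<forall>b\<in>carrier A. cmod (\<Psi> (a, b)) \<le> K * (vnorm A a * vnorm A b))"

text \<open>The clause \<open>0 \<le> K\<close> keeps the infimum meaningful when all products of
  norms vanish, for then every real number is a bound of the zero form.\<close>

definition form_norm :: "'a cnormed \<Rightarrow> ('a \<times> 'a \<Rightarrow> complex) \<Rightarrow> real" where
  "form_norm A \<Psi> = Inf {K. 0 \<le> K \<and> form_bound A \<Psi> K}"

text \<open>This is the dual of the projective tensor square of \<open>A\<close>, realised inside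
  the very type over which \<open>amenable\<close> lets bimodules range.\<close>

definition bilinear_forms :: "'a cnormed \<Rightarrow> ('a \<times> 'a \<Rightarrow> complex) set" where
  "bilinear_forms A = {\<Psi>.
     (\<forall>p. p \<notin> carrier A \<times> carrier A \<longrightarrow> \<Psi> p = 0) \<and>
     (\<forall>a\<in>carrier A. \<forall>b\<in>carrier A. \<forall>c\<in>carrier A. \<Psi> (a \<oplus>\<^bsub>A\<^esub> b, c) = \<Psi> (a, c) + \<Psi> (b, c)) \<and>
     (\<forall>a\<in>carrier A. \<forall>b\<in>carrier A. \<forall>c\<in>carrier A. \<Psi> (a, b \<oplus>\<^bsub>A\<^esub> c) = \<Psi> (a, b) + \<Psi> (a, c)) \<and>
     (\<forall>z. \<forall>a\<in>carrier A. \<forall>b\<in>carrier A. \<Psi> (z \<odot>\<^bsub>A\<^esub> a, b) = z * \<Psi> (a, b)) \<and>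
     (\<forall>z. \<forall>a\<in>carrier A. \<forall>b\<in>carrier A. \<Psi> (a, z \<odot>\<^bsub>A\<^esub> b) = z * \<Psi> (a, b)) \<and>
     (\<exists>K. form_bound A \<Psi> K)}"

definition form_space :: "'a cnormed \<Rightarrow> ('a \<times> 'a \<Rightarrow> complex) set \<Rightarrow> ('a \<times> 'a \<Rightarrow> complex) cnormed" where
  "form_space A S =
     \<lparr>carrier = S, monoid.mult = undefined, one = undefined,
      zero = (\<lambda>p. 0), add = (\<lambda>\<Psi> \<Phi> p. \<Psi> p + \<Phi> p),
      smult = (\<lambda>c \<Psi> p. c * \<Psi> p), vnorm = form_norm A\<rparr>"

text \<open>Closedness is stated as approximability within every positive \<open>e\<close>, so that
  membership is shown by estimates with \<open>form_bound\<close> and without choosing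
  sequences.\<close>

definition closed_form_space :: "'a cnormed \<Rightarrow> ('a \<times> 'a \<Rightarrow> complex) set \<Rightarrow> bool" where
  "closed_form_space A S \<longleftrightarrow> S \<subseteq> bilinear_forms A \<and> (\<lambda>p. 0) \<in> S \<and>
     (\<forall>\<Psi>\<in>S. \<forall>\<Phi>\<in>S. (\<lambda>p. \<Psi> p + \<Phi> p) \<in> S) \<and> (\<forall>z. \<forall>\<Psi>\<in>S. (\<lambda>p. z * \<Psi> p) \<in> S) \<and>
     (\<forall>\<Psi>\<in>bilinear_forms A.
        (\<forall>e>0. \<exists>\<Phi>\<in>S. form_bound A (\<lambda>p. \<Psi> p - \<Phi> p) e) \<longrightarrow> \<Psi> \<in> S)"

lemma form_of_apply [simp]: "a \<in> carrier A \<Longrightarrow> b \<in> carrier A \<Longrightarrow> form_of A F (a, b) = F a b"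
  by (simp add: form_of_def)

lemma form_of_outside: "p \<notin> carrier A \<times> carrier A \<Longrightarrow> form_of A F p = 0"
  by (cases p) (auto simp: form_of_def)

lemma bilinear_formsD:
  assumes "\<Psi> \<in> bilinear_forms A"
  shows "p \<notin> carrier A \<times> carrier A \<Longrightarrow> \<Psi> p = 0"
    "a \<in> carrier A \<Longrightarrow> b \<in> carrier A \<Longrightarrow> c \<in> carrier A \<Longrightarrow> \<Psi> (a \<oplus>\<^bsub>A\<^esub> b, c) = \<Psi> (a, c) + \<Psi> (b, c)"
    "a \<in> carrier A \<Longrightarrow> b \<in> carrier A \<Longrightarrow> c \<in> carrier A \<Longrightarrow> \<Psi> (a, b \<oplus>\<^bsub>A\<^esub> c) = \<Psi> (a, b) + \<Psi> (a, c)"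
    "a \<in> carrier A \<Longrightarrow> b \<in> carrier A \<Longrightarrow> \<Psi> (z \<odot>\<^bsub>A\<^esub> a, b) = z * \<Psi> (a, b)"
    "a \<in> carrier A \<Longrightarrow> b \<in> carrier A \<Longrightarrow> \<Psi> (a, z \<odot>\<^bsub>A\<^esub> b) = z * \<Psi> (a, b)"
    "\<exists>K. form_bound A \<Psi> K"
  using assms unfolding bilinear_forms_def by blast+

lemma form_eqI:
  assumes "\<And>p. p \<notin> carrier A \<times> carrier A \<Longrightarrow> \<Psi> p = 0" "\<And>p. p \<notin> carrier A \<times> carrier A \<Longrightarrow> \<Phi> p = 0"
    and "\<And>a b. a \<in> carrier A \<Longrightarrow> b \<in> carrier A \<Longrightarrow> \<Psi> (a, b) = \<Phi> (a, b)"
  shows "\<Psi> = \<Phi>"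
proof
  fix p show "\<Psi> p = \<Phi> p"
    using assms by (cases "p \<in> carrier A \<times> carrier A") auto
qed

lemma form_space_simps [simp]:
  "carrier (form_space A S) = S" "\<zero>\<^bsub>form_space A S\<^esub> = (\<lambda>p. 0)"
  "\<Psi> \<oplus>\<^bsub>form_space A S\<^esub> \<Phi> = (\<lambda>p. \<Psi> p + \<Phi> p)" "z \<odot>\<^bsub>form_space A S\<^esub> \<Psi> = (\<lambda>p. z * \<Psi> p)"
  "vnorm (form_space A S) = form_norm A"
  by (simp_all add: form_space_def)

section \<open>The Banach space of bounded bilinear forms\<close>

context banach_algebra
begin

lemma form_bound_mono:
  assumes "form_bound A \<Psi> K" "K \<le> L"
  shows "form_bound A \<Psi> L"
  unfolding form_bound_def
proof (intro ballI)
  fix a b assume ab: "a \<in> carrier A" "b \<in> carrier A"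
  have "cmod (\<Psi> (a, b)) \<le> K * (vnorm A a * vnorm A b)"
    using assms ab by (auto simp: form_bound_def)
  also have "\<dots> \<le> L * (vnorm A a * vnorm A b)"
    using assms ab by (intro mult_right_mono mult_nonneg_nonneg vnorm_nonneg)
  finally show "cmod (\<Psi> (a, b)) \<le> L * (vnorm A a * vnorm A b)" .
qed

lemma form_norm_le: "form_bound A \<Psi> K \<Longrightarrow> 0 \<le> K \<Longrightarrow> form_norm A \<Psi> \<le> K"
  unfolding form_norm_def by (rule cInf_lower) (auto intro: bdd_belowI)

lemma form_bound_nonneg_ex:
  assumes "\<Psi> \<in> bilinear_forms A"
  shows "\<exists>K. 0 \<le> K \<and> form_bound A \<Psi> K"
proof -
  obtain K where "form_bound A \<Psi> K" using bilinear_formsD(6)[OF assms] ..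
  then have "form_bound A \<Psi> (max 0 K)" by (rule form_bound_mono) simp
  then show ?thesis by (intro exI[of _ "max 0 K"]) simp
qed

lemma form_norm_nonneg: "\<Psi> \<in> bilinear_forms A \<Longrightarrow> 0 \<le> form_norm A \<Psi>"
  unfolding form_norm_def using form_bound_nonneg_ex by (intro cInf_greatest) auto

text \<open>Where the product of the two norms is positive, dividing by it turns every admissible
  constant into an upper bound of one fixed number. Where it is zero, any bound forces the form to
  vanish. Hence the infimum is itself admissible.\<close>

lemma form_bound_norm:
  assumes \<Psi>: "\<Psi> \<in> bilinear_forms A"
  shows "form_bound A \<Psi> (form_norm A \<Psi>)"
  unfolding form_bound_def
proof (intro ballI)
  fix a b assume ab: "a \<in> carrier A" "b \<in> carrier A"
  let ?n = "vnorm A a * vnorm A b"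
  have n: "?n \<ge> 0" using ab by (intro mult_nonneg_nonneg vnorm_nonneg)
  show "cmod (\<Psi> (a, b)) \<le> form_norm A \<Psi> * ?n"
  proof (cases "?n = 0")
    case True
    then show ?thesis
      using bilinear_formsD(6)[OF \<Psi>] ab unfolding form_bound_def by (metis mult_zero_right)
  next
    case False
    with n have n_pos: "?n > 0" by linarith
    have "cmod (\<Psi> (a, b)) / ?n \<le> form_norm A \<Psi>"
      unfolding form_norm_def
    proof (rule cInf_greatest)
      show "{K. 0 \<le> K \<and> form_bound A \<Psi> K} \<noteq> {}"
        using form_bound_nonneg_ex[OF \<Psi>] by blast
      fix K assume "K \<in> {K. 0 \<le> K \<and> form_bound A \<Psi> K}"
      then show "cmod (\<Psi> (a, b)) / ?n \<le> K"
        using ab by (auto simp: form_bound_def pos_divide_le_eq[OF n_pos])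
    qed
    then show ?thesis
      by (simp add: pos_divide_le_eq[OF n_pos])
  qed
qed

lemma form_normD:
  "\<Psi> \<in> bilinear_forms A \<Longrightarrow> a \<in> carrier A \<Longrightarrow> b \<in> carrier A \<Longrightarrow>
    cmod (\<Psi> (a, b)) \<le> form_norm A \<Psi> * (vnorm A a * vnorm A b)"
  using form_bound_norm by (auto simp: form_bound_def)

lemma form_bound_add:
  "form_bound A \<Psi> K \<Longrightarrow> form_bound A \<Phi> L \<Longrightarrow> form_bound A (\<lambda>p. \<Psi> p + \<Phi> p) (K + L)"
  unfolding form_bound_def by (auto simp: distrib_right intro!: norm_triangle_mono)

lemma form_bound_scale: "form_bound A \<Psi> K \<Longrightarrow> form_bound A (\<lambda>p. z * \<Psi> p) (cmod z * K)"
  unfolding form_bound_def by (auto simp: norm_mult mult.assoc intro!: mult_left_mono)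

lemma bilinear_forms_zero: "(\<lambda>p. 0) \<in> bilinear_forms A"
  by (auto simp: bilinear_forms_def form_bound_def intro: exI[of _ 0])

lemma bilinear_forms_add:
  assumes "\<Psi> \<in> bilinear_forms A" "\<Phi> \<in> bilinear_forms A"
  shows "(\<lambda>p. \<Psi> p + \<Phi> p) \<in> bilinear_forms A"
proof -
  have "\<exists>K. form_bound A (\<lambda>p. \<Psi> p + \<Phi> p) K"
    using form_bound_add form_bound_norm assms by blast
  then show ?thesis
    using assms by (simp add: bilinear_forms_def algebra_simps)
qed

lemma bilinear_forms_scale:
  assumes "\<Psi> \<in> bilinear_forms A"
  shows "(\<lambda>p. z * \<Psi> p) \<in> bilinear_forms A"
proof -
  have "\<exists>K. form_bound A (\<lambda>p. z * \<Psi> p) K"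
    using form_bound_scale form_bound_norm assms by blast
  then show ?thesis
    using assms by (simp add: bilinear_forms_def algebra_simps)
qed

lemma form_norm_scale:
  assumes "\<Psi> \<in> bilinear_forms A"
  shows "form_norm A (\<lambda>p. z * \<Psi> p) = cmod z * form_norm A \<Psi>"
proof -
  have le: "form_norm A (\<lambda>p. w * \<Phi> p) \<le> cmod w * form_norm A \<Phi>" if "\<Phi> \<in> bilinear_forms A" for w \<Phi>
    using that by (intro form_norm_le form_bound_scale form_bound_norm mult_nonneg_nonneg
        form_norm_nonneg) auto
  show ?thesis
  proof (cases "z = 0")
    case True
    then show ?thesis
      using le[OF assms, of 0] form_norm_nonneg[OF bilinear_forms_zero] by simp
  next
    case False
    \<comment> \<open>Undoing the scaling with \<open>inverse z\<close> gives the reverse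
      inequality.\<close>
    have "form_norm A (\<lambda>p. inverse z * (z * \<Psi> p)) \<le> cmod (inverse z) * form_norm A (\<lambda>p. z * \<Psi> p)"
      by (rule le) (rule bilinear_forms_scale[OF assms])
    moreover have "(\<lambda>p. inverse z * (z * \<Psi> p)) = \<Psi>"
      using False by (simp add: field_simps)
    ultimately have "cmod z * form_norm A \<Psi> \<le> form_norm A (\<lambda>p. z * \<Psi> p)"
      using False by (simp add: norm_inverse norm_divide divide_simps mult.commute)
    then show ?thesis using le[OF assms, of z] by simp
  qed
qed

lemma form_norm_triangle:
  assumes "\<Psi> \<in> bilinear_forms A" "\<Phi> \<in> bilinear_forms A"
  shows "form_norm A (\<lambda>p. \<Psi> p + \<Phi> p) \<le> form_norm A \<Psi> + form_norm A \<Phi>"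
  using assms by (intro form_norm_le form_bound_add form_bound_norm add_nonneg_nonneg
      form_norm_nonneg)

text \<open>Each instance of bilinearity and of the bound involves finitely many values of the form,
  so it survives pointwise limits. This is the lower semicontinuity that
  \<open>pointwise_space_banach\<close> asks for.\<close>

lemma bilinear_forms_limit:
  assumes s: "\<And>n::nat. s n \<in> bilinear_forms A" and K: "\<And>n. form_norm A (s n) \<le> K"
    and lim: "\<And>p. (\<lambda>n. s n p) \<longlonglongrightarrow> \<Psi> p"
  shows "\<Psi> \<in> bilinear_forms A \<and> form_norm A \<Psi> \<le> K"
proof -
  note unique = LIMSEQ_unique[OF lim]
  have bound: "form_bound A \<Psi> K"
    unfolding form_bound_def
  proof (intro ballI)
    fix a b assume "a \<in> carrier A" "b \<in> carrier A"
    then have "cmod (s n (a, b)) \<le> K * (vnorm A a * vnorm A b)" for n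
      using form_bound_mono[OF form_bound_norm[OF s] K] by (auto simp: form_bound_def)
    then show "cmod (\<Psi> (a, b)) \<le> K * (vnorm A a * vnorm A b)"
      by (intro Lim_bounded[OF tendsto_norm[OF lim]]) auto
  qed
  have "\<Psi> p = 0" if "p \<notin> carrier A \<times> carrier A" for p
    by (rule unique) (simp add: bilinear_formsD(1)[OF s that])
  moreover have "\<Psi> (a \<oplus> b, c) = \<Psi> (a, c) + \<Psi> (b, c)" "\<Psi> (c, a \<oplus> b) = \<Psi> (c, a) + \<Psi> (c, b)"
    if "a \<in> carrier A" "b \<in> carrier A" "c \<in> carrier A" for a b c
    using that tendsto_add[OF lim lim] by (auto intro!: unique simp: bilinear_formsD(2,3)[OF s])
  moreover have "\<Psi> (z \<odot> a, b) = z * \<Psi> (a, b)" "\<Psi> (a, z \<odot> b) = z * \<Psi> (a, b)"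
    if "a \<in> carrier A" "b \<in> carrier A" for z a b
    using that tendsto_mult_left[OF lim] by (auto intro!: unique simp: bilinear_formsD(4,5)[OF s])
  moreover have "0 \<le> K"
    using form_norm_nonneg[OF s] K order_trans by blast
  ultimately show ?thesis
    using bound by (auto simp: bilinear_forms_def form_norm_le)
qed

lemma closed_form_spaceD:
  assumes "closed_form_space A S"
  shows "\<Psi> \<in> S \<Longrightarrow> \<Psi> \<in> bilinear_forms A" "(\<lambda>p. 0) \<in> S"
    "\<Psi> \<in> S \<Longrightarrow> \<Phi> \<in> S \<Longrightarrow> (\<lambda>p. \<Psi> p + \<Phi> p) \<in> S" "\<Psi> \<in> S \<Longrightarrow> (\<lambda>p. z * \<Psi> p) \<in> S"
    "\<Psi> \<in> bilinear_forms A \<Longrightarrow> (\<And>e. e > 0 \<Longrightarrow> \<exists>\<Phi>\<in>S. form_bound A (\<lambda>p. \<Psi> p - \<Phi> p) e) \<Longrightarrow> \<Psi> \<in> S"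
  using assms unfolding closed_form_space_def by blast+

lemma pointwise_form_space: "closed_form_space A S \<Longrightarrow> pointwise_space (form_space A S)"
  by (simp add: pointwise_space_def closed_form_space_def form_space_def)

lemma form_space_banach:
  assumes S: "closed_form_space A S"
  shows "banach_space (form_space A S)"
proof (rule pointwise_space_banach[OF pointwise_form_space[OF S], where T = "bilinear_forms A"],
    unfold form_space_simps)
  note SD = closed_form_spaceD[OF S]
  show "S \<subseteq> bilinear_forms A" using SD by blast
  show "\<exists>k. \<forall>\<Psi>\<in>S. cmod (\<Psi> p) \<le> k * form_norm A \<Psi>" for p
  proof (cases "p \<in> carrier A \<times> carrier A")
    case True
    then show ?thesis
      using form_normD[OF SD(1)]
      by (intro exI[of _ "vnorm A (fst p) * vnorm A (snd p)"]) (auto simp: mult.commute)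
  next
    case False
    then show ?thesis
      using bilinear_formsD(1)[OF SD(1)] by (intro exI[of _ 0]) auto
  qed
  show "\<Psi> \<in> bilinear_forms A \<and> form_norm A \<Psi> \<le> K"
    if "\<And>n::nat. s n \<in> bilinear_forms A" "\<And>n. form_norm A (s n) \<le> K"
      "\<And>p. (\<lambda>n. s n p) \<longlonglongrightarrow> \<Psi> p" for s \<Psi> K
    using that by (rule bilinear_forms_limit)
  show "\<Psi> \<in> S" if \<Psi>: "\<Psi> \<in> bilinear_forms A"
    and ex: "\<And>e. e > 0 \<Longrightarrow> \<exists>\<Phi>\<in>S. form_norm A (\<lambda>p. \<Psi> p - \<Phi> p) \<le> e" for \<Psi>
  proof (rule SD(5)[OF \<Psi>])
    fix e :: real assume "e > 0"
    then obtain \<Phi> where \<Phi>: "\<Phi> \<in> S" "form_norm A (\<lambda>p. \<Psi> p - \<Phi> p) \<le> e"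
      using ex by blast
    have "(\<lambda>p. \<Psi> p - \<Phi> p) \<in> bilinear_forms A"
      using bilinear_forms_add[OF \<Psi> bilinear_forms_scale[OF SD(1)[OF \<Phi>(1)], of "-1"]] by simp
    then show "\<exists>\<Phi>\<in>S. form_bound A (\<lambda>p. \<Psi> p - \<Phi> p) e"
      using form_bound_mono[OF form_bound_norm \<Phi>(2)] \<Phi>(1) by blast
  qed
qed (use closed_form_spaceD(1)[OF S] form_norm_nonneg form_norm_triangle form_norm_scale in auto)

section \<open>Forms composed with multiplication by a fixed element\<close>

lemma form_bound_left:
  assumes \<Psi>: "form_bound A \<Psi> K" "0 \<le> K" and c: "c \<in> carrier A"
  shows "form_bound A (form_of A (\<lambda>a b. \<Psi> (c \<otimes> a, b))) (vnorm A c * K)"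
  unfolding form_bound_def
proof (intro ballI)
  fix a b assume ab: "a \<in> carrier A" "b \<in> carrier A"
  have "cmod (\<Psi> (c \<otimes> a, b)) \<le> K * (vnorm A (c \<otimes> a) * vnorm A b)"
    using \<Psi>(1) c ab by (simp add: form_bound_def mult_closed)
  also have "\<dots> \<le> K * ((vnorm A c * vnorm A a) * vnorm A b)"
    using \<Psi>(2) c ab by (intro mult_left_mono mult_right_mono vnorm_mult vnorm_nonneg)
  finally show "cmod (form_of A (\<lambda>a b. \<Psi> (c \<otimes> a, b)) (a, b)) \<le> vnorm A c * K * (vnorm A a * vnorm A b)"
    using ab by (simp add: algebra_simps)
qed

lemma form_bound_right:
  assumes \<Psi>: "form_bound A \<Psi> K" "0 \<le> K" and c: "c \<in> carrier A"
  shows "form_bound A (form_of A (\<lambda>a b. \<Psi> (a, b \<otimes> c))) (vnorm A c * K)"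
  unfolding form_bound_def
proof (intro ballI)
  fix a b assume ab: "a \<in> carrier A" "b \<in> carrier A"
  have "cmod (\<Psi> (a, b \<otimes> c)) \<le> K * (vnorm A a * vnorm A (b \<otimes> c))"
    using \<Psi>(1) c ab by (simp add: form_bound_def mult_closed)
  also have "\<dots> \<le> K * (vnorm A a * (vnorm A b * vnorm A c))"
    using \<Psi>(2) c ab by (intro mult_left_mono vnorm_mult vnorm_nonneg)
  finally show "cmod (form_of A (\<lambda>a b. \<Psi> (a, b \<otimes> c)) (a, b)) \<le> vnorm A c * K * (vnorm A a * vnorm A b)"
    using ab by (simp add: algebra_simps)
qed

lemma form_bound_mid:
  assumes \<Psi>: "form_bound A \<Psi> K" "0 \<le> K" and c: "c \<in> carrier A"
  shows "form_bound A (form_of A (\<lambda>a b. \<Psi> (a \<otimes> b, c))) (vnorm A c * K)"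
  unfolding form_bound_def
proof (intro ballI)
  fix a b assume ab: "a \<in> carrier A" "b \<in> carrier A"
  have "cmod (\<Psi> (a \<otimes> b, c)) \<le> K * (vnorm A (a \<otimes> b) * vnorm A c)"
    using \<Psi>(1) c ab by (simp add: form_bound_def mult_closed)
  also have "\<dots> \<le> K * ((vnorm A a * vnorm A b) * vnorm A c)"
    using \<Psi>(2) c ab by (intro mult_left_mono mult_right_mono vnorm_mult vnorm_nonneg)
  finally show "cmod (form_of A (\<lambda>a b. \<Psi> (a \<otimes> b, c)) (a, b)) \<le> vnorm A c * K * (vnorm A a * vnorm A b)"
    using ab by (simp add: algebra_simps)
qed

lemma bilinear_forms_left:
  assumes \<Psi>: "\<Psi> \<in> bilinear_forms A" and c: "c \<in> carrier A"
  shows "form_of A (\<lambda>a b. \<Psi> (c \<otimes> a, b)) \<in> bilinear_forms A"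
proof -
  have "\<exists>K. form_bound A (form_of A (\<lambda>a b. \<Psi> (c \<otimes> a, b))) K"
    using form_bound_left[OF form_bound_norm form_norm_nonneg] assms by blast
  then show ?thesis
    using c bilinear_formsD(2-5)[OF \<Psi>]
    by (simp add: bilinear_forms_def form_of_outside mult_closed mult_distrib_left smult_mult_right)
qed

lemma bilinear_forms_right:
  assumes \<Psi>: "\<Psi> \<in> bilinear_forms A" and c: "c \<in> carrier A"
  shows "form_of A (\<lambda>a b. \<Psi> (a, b \<otimes> c)) \<in> bilinear_forms A"
proof -
  have "\<exists>K. form_bound A (form_of A (\<lambda>a b. \<Psi> (a, b \<otimes> c))) K"
    using form_bound_right[OF form_bound_norm form_norm_nonneg] assms by blast
  then show ?thesis
    using c bilinear_formsD(2-5)[OF \<Psi>]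
    by (simp add: bilinear_forms_def form_of_outside mult_closed mult_distrib_right smult_mult_left)
qed

lemma bilinear_forms_mid:
  assumes \<Psi>: "\<Psi> \<in> bilinear_forms A" and c: "c \<in> carrier A"
  shows "form_of A (\<lambda>a b. \<Psi> (a \<otimes> b, c)) \<in> bilinear_forms A"
proof -
  have "\<exists>K. form_bound A (form_of A (\<lambda>a b. \<Psi> (a \<otimes> b, c))) K"
    using form_bound_mid[OF form_bound_norm form_norm_nonneg] assms by blast
  then show ?thesis
    using c bilinear_formsD(2-5)[OF \<Psi>]
    by (simp add: bilinear_forms_def form_of_outside mult_closed mult_distrib_left mult_distrib_right
        smult_mult_left smult_mult_right)
qed

end

text \<open>Taking limits is one of the generating rules instead of a final closure, so a single
  induction shows that a bounded operator maps the span into itself.\<close>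

inductive_set closed_form_span :: "'a cnormed \<Rightarrow> ('a \<times> 'a \<Rightarrow> complex) set \<Rightarrow> ('a \<times> 'a \<Rightarrow> complex) set"
  for A :: "'a cnormed" and X :: "('a \<times> 'a \<Rightarrow> complex) set" where
  base: "\<Psi> \<in> X \<Longrightarrow> \<Psi> \<in> closed_form_span A X"
| zero: "(\<lambda>p. 0) \<in> closed_form_span A X"
| add: "\<Psi> \<in> closed_form_span A X \<Longrightarrow> \<Phi> \<in> closed_form_span A X \<Longrightarrow>
    (\<lambda>p. \<Psi> p + \<Phi> p) \<in> closed_form_span A X"
| scale: "\<Psi> \<in> closed_form_span A X \<Longrightarrow> (\<lambda>p. z * \<Psi> p) \<in> closed_form_span A X"
| limit: "\<Psi> \<in> bilinear_forms A \<Longrightarrow>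
    \<forall>e>0. \<exists>\<Phi>. \<Phi> \<in> closed_form_span A X \<and> form_bound A (\<lambda>p. \<Psi> p - \<Phi> p) e \<Longrightarrow>
    \<Psi> \<in> closed_form_span A X"

lemma closed_form_span_sum:
  assumes "finite F" "\<And>i. i \<in> F \<Longrightarrow> \<Psi> i \<in> closed_form_span A X"
  shows "(\<lambda>p. \<Sum>i\<in>F. \<Psi> i p) \<in> closed_form_span A X"
  using assms by (induction F) (auto intro: closed_form_span.intros)

context banach_algebra
begin

lemma closed_form_space_span:
  assumes "X \<subseteq> bilinear_forms A"
  shows "closed_form_space A (closed_form_span A X)"
proof -
  have sub: "\<Psi> \<in> bilinear_forms A" if "\<Psi> \<in> closed_form_span A X" for \<Psi>
    using that assms
    by induction (auto intro: bilinear_forms_zero bilinear_forms_add bilinear_forms_scale)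
  show ?thesis
    unfolding closed_form_space_def Bex_def
    by (intro conjI subsetI ballI allI impI)
      (assumption | erule sub | simp only: closed_form_span.zero | erule (1) closed_form_span.add
        | erule closed_form_span.scale | erule (1) closed_form_span.limit)+
qed

text \<open>Continuity handles the limit rule: \<open>T\<close> worsens an approximation at most by
  the factor \<open>L\<close>. Stability of a closed span under an operator is thereby reduced to
  its generators.\<close>

lemma closed_form_span_map:
  assumes base: "\<And>\<Psi>. \<Psi> \<in> X \<Longrightarrow> T \<Psi> \<in> closed_form_span A X"
    and zero: "T (\<lambda>p. 0) = (\<lambda>p. 0)"
    and add: "\<And>\<Psi> \<Phi>. T (\<lambda>p. \<Psi> p + \<Phi> p) = (\<lambda>p. T \<Psi> p + T \<Phi> p)"
    and scale: "\<And>z \<Psi>. T (\<lambda>p. z * \<Psi> p) = (\<lambda>p. z * T \<Psi> p)"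
    and bilinear: "\<And>\<Psi>. \<Psi> \<in> bilinear_forms A \<Longrightarrow> T \<Psi> \<in> bilinear_forms A"
    and bound: "\<And>\<Psi> K. form_bound A \<Psi> K \<Longrightarrow> 0 \<le> K \<Longrightarrow> form_bound A (T \<Psi>) (L * K)"
    and L: "0 \<le> L"
    and \<Psi>: "\<Psi> \<in> closed_form_span A X"
  shows "T \<Psi> \<in> closed_form_span A X"
  using \<Psi>
proof induction
  case (limit \<Psi>)
  have "\<exists>\<Phi>. \<Phi> \<in> closed_form_span A X \<and> form_bound A (\<lambda>p. T \<Psi> p - \<Phi> p) e" if "e > 0" for e
  proof -
    \<comment> \<open>Dividing by \<open>L + 1\<close> rather than by \<open>L\<close> covers the
      case \<open>L = 0\<close>.\<close>
    have e: "e / (L + 1) > 0" using that L by simp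
    obtain \<Phi> where \<Phi>: "T \<Phi> \<in> closed_form_span A X" "form_bound A (\<lambda>p. \<Psi> p - \<Phi> p) (e / (L + 1))"
      using limit(2) e by blast
    \<comment> \<open>Only additivity and homogeneity of \<open>T\<close> are assumed, so the
      difference is first written as a sum with the factor -1.\<close>
    have "T (\<lambda>p. \<Psi> p + (-1) * \<Phi> p) = (\<lambda>p. T \<Psi> p + (-1) * T \<Phi> p)"
      by (simp only: add scale)
    then have "T (\<lambda>p. \<Psi> p - \<Phi> p) = (\<lambda>p. T \<Psi> p - T \<Phi> p)" by simp
    with bound[OF \<Phi>(2)] e have "form_bound A (\<lambda>p. T \<Psi> p - T \<Phi> p) (L * (e / (L + 1)))" by simp
    then have "form_bound A (\<lambda>p. T \<Psi> p - T \<Phi> p) e"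
      by (rule form_bound_mono) (use L that in \<open>simp add: field_simps\<close>)
    with \<Phi>(1) show ?thesis by blast
  qed
  then show ?case
    by (intro closed_form_span.limit bilinear limit(1)) blast
qed (simp_all only: base zero add scale closed_form_span.intros)

lemma closed_form_span_left:
  assumes "\<And>\<Psi>. \<Psi> \<in> X \<Longrightarrow> form_of A (\<lambda>a b. \<Psi> (c \<otimes> a, b)) \<in> closed_form_span A X"
    and "c \<in> carrier A" "\<Psi> \<in> closed_form_span A X"
  shows "form_of A (\<lambda>a b. \<Psi> (c \<otimes> a, b)) \<in> closed_form_span A X"
  by (rule closed_form_span_map[where T = "\<lambda>\<Psi>. form_of A (\<lambda>a b. \<Psi> (c \<otimes> a, b))", OF assms(1)
        _ _ _ bilinear_forms_left[OF _ assms(2)] form_bound_left[OF _ _ assms(2)]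
        vnorm_nonneg[OF assms(2)] assms(3)])
    (auto simp: form_of_def)

lemma closed_form_span_right:
  assumes "\<And>\<Psi>. \<Psi> \<in> X \<Longrightarrow> form_of A (\<lambda>a b. \<Psi> (a, b \<otimes> c)) \<in> closed_form_span A X"
    and "c \<in> carrier A" "\<Psi> \<in> closed_form_span A X"
  shows "form_of A (\<lambda>a b. \<Psi> (a, b \<otimes> c)) \<in> closed_form_span A X"
  by (rule closed_form_span_map[where T = "\<lambda>\<Psi>. form_of A (\<lambda>a b. \<Psi> (a, b \<otimes> c))", OF assms(1)
        _ _ _ bilinear_forms_right[OF _ assms(2)] form_bound_right[OF _ _ assms(2)]
        vnorm_nonneg[OF assms(2)] assms(3)])
    (auto simp: form_of_def)

lemma closed_form_span_mid:
  assumes "\<And>\<Psi>. \<Psi> \<in> X \<Longrightarrow> form_of A (\<lambda>a b. \<Psi> (a \<otimes> b, c)) \<in> closed_form_span A X"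
    and "c \<in> carrier A" "\<Psi> \<in> closed_form_span A X"
  shows "form_of A (\<lambda>a b. \<Psi> (a \<otimes> b, c)) \<in> closed_form_span A X"
  by (rule closed_form_span_map[where T = "\<lambda>\<Psi>. form_of A (\<lambda>a b. \<Psi> (a \<otimes> b, c))", OF assms(1)
        _ _ _ bilinear_forms_mid[OF _ assms(2)] form_bound_mid[OF _ _ assms(2)]
        vnorm_nonneg[OF assms(2)] assms(3)])
    (auto simp: form_of_def)

end

section \<open>Dual bimodules and a bimodule of bilinear forms\<close>

lemma dual_space_simps [simp]:
  "\<zero>\<^bsub>dual_space E\<^esub> = (\<lambda>x. 0)" "\<phi> \<oplus>\<^bsub>dual_space E\<^esub> \<psi> = (\<lambda>x. \<phi> x + \<psi> x)"
  "z \<odot>\<^bsub>dual_space E\<^esub> \<phi> = (\<lambda>x. z * \<phi> x)"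
  by (simp_all add: dual_space_def)

lemma dual_spaceD:
  assumes "\<phi> \<in> carrier (dual_space E)"
  shows "x \<notin> carrier E \<Longrightarrow> \<phi> x = 0"
    "x \<in> carrier E \<Longrightarrow> y \<in> carrier E \<Longrightarrow> \<phi> (x \<oplus>\<^bsub>E\<^esub> y) = \<phi> x + \<phi> y"
    "x \<in> carrier E \<Longrightarrow> \<phi> (z \<odot>\<^bsub>E\<^esub> x) = z * \<phi> x"
    "\<exists>K. \<forall>x\<in>carrier E. cmod (\<phi> x) \<le> K * vnorm E x"
  using assms by (auto simp: dual_space_def bounded_linear_map_def)

lemma dual_spaceI:
  assumes "\<And>x. x \<notin> carrier E \<Longrightarrow> \<phi> x = 0"
    "\<And>x y. x \<in> carrier E \<Longrightarrow> y \<in> carrier E \<Longrightarrow> \<phi> (x \<oplus>\<^bsub>E\<^esub> y) = \<phi> x + \<phi> y"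
    "\<And>z x. x \<in> carrier E \<Longrightarrow> \<phi> (z \<odot>\<^bsub>E\<^esub> x) = z * \<phi> x"
    "\<And>x. x \<in> carrier E \<Longrightarrow> cmod (\<phi> x) \<le> K * vnorm E x"
  shows "\<phi> \<in> carrier (dual_space E)"
  using assms by (auto simp: dual_space_def bounded_linear_map_def intro: exI[of _ K])

text \<open>Through \<open>pointwise_space_minus\<close> this allows the subtraction in
  \<open>inner_derivation\<close> to be read as pointwise subtraction of functionals.\<close>

lemma (in banach_space) pointwise_dual_space: "pointwise_space (dual_space V)"
proof -
  have "(\<lambda>x. \<phi> x + \<psi> x) \<in> carrier (dual_space V)"
    if \<phi>: "\<phi> \<in> carrier (dual_space V)" and \<psi>: "\<psi> \<in> carrier (dual_space V)" for \<phi> \<psi>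
  proof -
    obtain K L where KL: "\<And>x. x \<in> carrier V \<Longrightarrow> cmod (\<phi> x) \<le> K * vnorm V x"
        "\<And>x. x \<in> carrier V \<Longrightarrow> cmod (\<psi> x) \<le> L * vnorm V x"
      using dual_spaceD(4)[OF \<phi>] dual_spaceD(4)[OF \<psi>] by blast
    show ?thesis
      using dual_spaceD(1-3)[OF \<phi>] dual_spaceD(1-3)[OF \<psi>] KL
      by (intro dual_spaceI[where K = "K + L"])
        (auto simp: algebra_simps intro!: norm_triangle_mono)
  qed
  moreover have "(\<lambda>x. z * \<phi> x) \<in> carrier (dual_space V)"
    if \<phi>: "\<phi> \<in> carrier (dual_space V)" for z \<phi>
  proof -
    obtain K where K: "\<And>x. x \<in> carrier V \<Longrightarrow> cmod (\<phi> x) \<le> K * vnorm V x"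
      using dual_spaceD(4)[OF \<phi>] by blast
    have "cmod (z * \<phi> x) \<le> cmod z * K * vnorm V x" if "x \<in> carrier V" for x
      using mult_left_mono[OF K[OF that], of "cmod z"] by (simp add: norm_mult mult.assoc)
    then show ?thesis
      using dual_spaceD(1-3)[OF \<phi>]
      by (intro dual_spaceI[where K = "cmod z * K"]) (auto simp: algebra_simps)
  qed
  moreover have "(\<lambda>x. 0) \<in> carrier (dual_space V)"
    by (rule dual_spaceI[where K = 0]) auto
  ultimately show ?thesis
    by (simp add: pointwise_space_def) (simp add: dual_space_def)
qed

text \<open>The transpose of a bounded operator is bounded, and both actions on the dual of a
  bimodule are such transposes.\<close>

lemma (in banach_space) dual_space_compose:
  assumes \<phi>: "\<phi> \<in> carrier (dual_space V)"
    and T: "\<And>x. x \<in> carrier V \<Longrightarrow> T x \<in> carrier V"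
      "\<And>x y. x \<in> carrier V \<Longrightarrow> y \<in> carrier V \<Longrightarrow> T (x \<oplus> y) = T x \<oplus> T y"
      "\<And>z x. x \<in> carrier V \<Longrightarrow> T (z \<odot> x) = z \<odot> T x"
      "\<And>x. x \<in> carrier V \<Longrightarrow> vnorm V (T x) \<le> L * vnorm V x"
  shows "(\<lambda>x. if x \<in> carrier V then \<phi> (T x) else 0) \<in> carrier (dual_space V)"
proof -
  obtain K where K: "\<And>x. x \<in> carrier V \<Longrightarrow> cmod (\<phi> x) \<le> K * vnorm V x"
    using dual_spaceD(4)[OF \<phi>] by blast
  show ?thesis
  proof (rule dual_spaceI[where K = "\<bar>K\<bar> * L"])
    fix x assume x: "x \<in> carrier V"
    have "cmod (\<phi> (T x)) \<le> K * vnorm V (T x)" using K T(1) x by blast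
    also have "\<dots> \<le> \<bar>K\<bar> * vnorm V (T x)"
      by (rule mult_right_mono) (use T(1) x vnorm_nonneg in auto)
    also have "\<dots> \<le> \<bar>K\<bar> * (L * vnorm V x)"
      by (rule mult_left_mono) (use T(4) x in auto)
    finally show "cmod (if x \<in> carrier V then \<phi> (T x) else 0) \<le> \<bar>K\<bar> * L * vnorm V x"
      using x by (simp add: mult.assoc)
  qed (simp_all add: T dual_spaceD(2,3)[OF \<phi>])
qed

lemma (in banach_bimodule) dual_left_closed:
  assumes "a \<in> carrier A" "\<phi> \<in> carrier (dual_space E)"
  shows "dual_left E r a \<phi> \<in> carrier (dual_space E)"
proof -
  obtain K where "\<And>x. x \<in> carrier E \<Longrightarrow> vnorm E (r x a) \<le> K * vnorm A a * vnorm E x"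
    using r_bounded assms(1) by blast
  with assms show ?thesis
    unfolding dual_left_def
    by (intro E.dual_space_compose[where L = "K * vnorm A a"])
      (simp_all add: r_closed r_add_left r_smult_left)
qed

lemma (in banach_bimodule) dual_right_closed:
  assumes "a \<in> carrier A" "\<phi> \<in> carrier (dual_space E)"
  shows "dual_right E l \<phi> a \<in> carrier (dual_space E)"
proof -
  obtain K where "\<And>x. x \<in> carrier E \<Longrightarrow> vnorm E (l a x) \<le> K * vnorm A a * vnorm E x"
    using l_bounded assms(1) by blast
  with assms show ?thesis
    unfolding dual_right_def
    by (intro E.dual_space_compose[where L = "K * vnorm A a"])
      (simp_all add: l_closed l_add_right l_smult_right)
qed

section \<open>The twisted bimodule of forms and the functional obtained from amenability\<close>

context banach_algebra
begin

text \<open>Viewed on elementary tensors as functionals on forms, the transposed actions of c are a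
  \<otimes> b \<mapsto> ca \<otimes> b from the left and a \<otimes> b \<mapsto> a \<otimes> bc - ab
  \<otimes> c from the right. Multiplication kills the image of the latter. In the presence of a
  unit u this twist makes c \<mapsto> u \<otimes> c a derivation.\<close>

lemma form_bimodule:
  assumes S: "closed_form_space A S"
    and r: "\<And>\<Psi> c. \<Psi> \<in> S \<Longrightarrow> c \<in> carrier A \<Longrightarrow> form_of A (\<lambda>a b. \<Psi> (c \<otimes> a, b)) \<in> S"
    and l: "\<And>\<Psi> c. \<Psi> \<in> S \<Longrightarrow> c \<in> carrier A \<Longrightarrow>
      form_of A (\<lambda>a b. \<Psi> (a, b \<otimes> c) - \<Psi> (a \<otimes> b, c)) \<in> S"
  shows "banach_bimodule A (form_space A S)
    (\<lambda>c \<Psi>. form_of A (\<lambda>a b. \<Psi> (a, b \<otimes> c) - \<Psi> (a \<otimes> b, c)))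
    (\<lambda>\<Psi> c. form_of A (\<lambda>a b. \<Psi> (c \<otimes> a, b)))"
proof -
  note SD = closed_form_spaceD[OF S]
  have A: "banach_algebra A" by unfold_locales
  have r_bound: "form_norm A (form_of A (\<lambda>a b. \<Psi> (c \<otimes> a, b))) \<le> 1 * vnorm A c * form_norm A \<Psi>"
    if \<Psi>: "\<Psi> \<in> S" and c: "c \<in> carrier A" for \<Psi> c
    using form_norm_le[OF form_bound_left[OF form_bound_norm form_norm_nonneg c]]
      SD(1)[OF \<Psi>] form_norm_nonneg vnorm_nonneg[OF c] by simp
  have l_bound: "form_norm A (form_of A (\<lambda>a b. \<Psi> (a, b \<otimes> c) - \<Psi> (a \<otimes> b, c)))
      \<le> 2 * vnorm A c * form_norm A \<Psi>"
    if \<Psi>: "\<Psi> \<in> S" and c: "c \<in> carrier A" for \<Psi> c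
  proof -
    note bnd = form_bound_norm[OF SD(1)[OF \<Psi>]] form_norm_nonneg[OF SD(1)[OF \<Psi>]]
    \<comment> \<open>The two halves of the twisted action are estimated separately, whence the
      constant 2.\<close>
    have "form_bound A (\<lambda>p. form_of A (\<lambda>a b. \<Psi> (a, b \<otimes> c)) p + (-1) * form_of A (\<lambda>a b. \<Psi> (a \<otimes> b, c)) p)
        (vnorm A c * form_norm A \<Psi> + cmod (-1) * (vnorm A c * form_norm A \<Psi>))"
      by (intro form_bound_add form_bound_scale form_bound_right[OF bnd c] form_bound_mid[OF bnd c])
    moreover have "(\<lambda>p. form_of A (\<lambda>a b. \<Psi> (a, b \<otimes> c)) p + (-1) * form_of A (\<lambda>a b. \<Psi> (a \<otimes> b, c)) p) =
        form_of A (\<lambda>a b. \<Psi> (a, b \<otimes> c) - \<Psi> (a \<otimes> b, c))"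
      by (auto simp: form_of_def)
    ultimately have "form_bound A (form_of A (\<lambda>a b. \<Psi> (a, b \<otimes> c) - \<Psi> (a \<otimes> b, c)))
        (2 * vnorm A c * form_norm A \<Psi>)"
      by (simp add: mult.assoc)
    then show ?thesis
      by (rule form_norm_le) (use bnd(2) vnorm_nonneg[OF c] in simp)
  qed
  have l_bounded: "\<exists>K. \<forall>a\<in>carrier A. \<forall>\<Psi>\<in>S.
      form_norm A (form_of A (\<lambda>a' b. \<Psi> (a', b \<otimes> a) - \<Psi> (a' \<otimes> b, a))) \<le> K * vnorm A a * form_norm A \<Psi>"
  proof (intro exI ballI)
    fix a \<Psi> assume "a \<in> carrier A" "\<Psi> \<in> S"
    from l_bound[OF this(2,1)] show "form_norm A (form_of A (\<lambda>a' b. \<Psi> (a', b \<otimes> a) - \<Psi> (a' \<otimes> b, a))) \<le> 2 * vnorm A a * form_norm A \<Psi>" .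
  qed
  have r_bounded: "\<exists>K. \<forall>a\<in>carrier A. \<forall>\<Psi>\<in>S.
      form_norm A (form_of A (\<lambda>a' b. \<Psi> (a \<otimes> a', b))) \<le> K * vnorm A a * form_norm A \<Psi>"
  proof (intro exI ballI)
    fix a \<Psi> assume "a \<in> carrier A" "\<Psi> \<in> S"
    from r_bound[OF this(2,1)] show "form_norm A (form_of A (\<lambda>a' b. \<Psi> (a \<otimes> a', b))) \<le> 1 * vnorm A a * form_norm A \<Psi>" .
  qed
  show ?thesis
  proof (intro banach_bimodule.intro banach_bimodule_axioms.intro A form_space_banach[OF S],
      unfold form_space_simps, goal_cases)
    case (1 a \<Psi>) then show ?case by (simp only: l[OF 1(2,1)])
  next
    case (2 a \<Psi>) then show ?case by (simp only: r[OF 2(2,1)])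
  next
    case (3 a b \<Psi>) then show ?case
      by (intro form_eqI[of A]) (simp_all add: form_of_outside mult_closed mult_distrib_left bilinear_formsD(2,3)[OF SD(1)[OF 3(3)]])
  next
    case (4 a \<Psi> \<Phi>) then show ?case
      by (intro form_eqI[of A]) (simp_all add: form_of_outside)
  next
    case (5 a \<Psi> z) then show ?case
      by (intro form_eqI[of A])
        (simp_all add: form_of_outside mult_closed smult_mult_right bilinear_formsD(4,5)[OF SD(1)[OF 5(2)]] right_diff_distrib)
  next
    case (6 a \<Psi> z) then show ?case
      by (intro form_eqI[of A]) (simp_all add: form_of_outside right_diff_distrib)
  next
    case (7 a \<Psi> \<Phi>) then show ?case
      by (intro form_eqI[of A]) (simp_all add: form_of_outside)
  next
    case (8 a b \<Psi>) then show ?case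
      by (intro form_eqI[of A]) (simp_all add: form_of_outside mult_closed mult_distrib_right bilinear_formsD(2)[OF SD(1)[OF 8(3)]])
  next
    case (9 a \<Psi> z) then show ?case
      by (intro form_eqI[of A]) (simp_all add: form_of_outside)
  next
    case (10 a \<Psi> z) then show ?case
      by (intro form_eqI[of A]) (simp_all add: form_of_outside mult_closed smult_mult_left bilinear_formsD(4)[OF SD(1)[OF 10(2)]])
  next
    \<comment> \<open>Applying the twisted action of \<open>b\<close> and then that of
      \<open>a\<close>, evaluated at (x, y), produces the value of \<open>\<Psi>\<close> at (x y a,
      b) twice with opposite signs; the rest is the action of the product.\<close>
    case (11 a b \<Psi>) then show ?case
      by (intro form_eqI[of A]) (simp_all add: form_of_outside mult_closed mult_assoc)
  next
    case (12 a b \<Psi>) then show ?case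
      by (intro form_eqI[of A]) (simp_all add: form_of_outside mult_closed mult_assoc)
  next
    case (13 a b \<Psi>) then show ?case
      by (intro form_eqI[of A]) (simp_all add: form_of_outside mult_closed mult_assoc)
  next
    case 14 show ?case by (rule l_bounded)
  next
    case 15 show ?case by (rule r_bounded)
  qed
qed

text \<open>Here \<open>m\<close> implements the derivation given by evaluation at
  \<open>(u, c)\<close>, and the actions are written out so that no dual space remains. The last
  property is this implementation with the twisted action split into two terms. At
  \<open>c = u\<close> its two terms on the left agree and cancel, which leaves the property before
  it.\<close>

lemma amenable_functional:
  assumes amen: "amenable A" and S: "closed_form_space A S"
    and u: "u \<in> carrier A" "\<And>a. a \<in> carrier A \<Longrightarrow> u \<otimes> a = a" "\<And>a. a \<in> carrier A \<Longrightarrow> a \<otimes> u = a"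
    and stable:
      "\<And>\<Psi> c. \<Psi> \<in> S \<Longrightarrow> c \<in> carrier A \<Longrightarrow> form_of A (\<lambda>a b. \<Psi> (c \<otimes> a, b)) \<in> S"
      "\<And>\<Psi> c. \<Psi> \<in> S \<Longrightarrow> c \<in> carrier A \<Longrightarrow> form_of A (\<lambda>a b. \<Psi> (a, b \<otimes> c)) \<in> S"
      "\<And>\<Psi> c. \<Psi> \<in> S \<Longrightarrow> c \<in> carrier A \<Longrightarrow> form_of A (\<lambda>a b. \<Psi> (a \<otimes> b, c)) \<in> S"
  obtains m K where
    "\<And>\<Psi> \<Phi>. \<Psi> \<in> S \<Longrightarrow> \<Phi> \<in> S \<Longrightarrow> m (\<lambda>p. \<Psi> p + \<Phi> p) = m \<Psi> + m \<Phi>"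
    "\<And>z \<Psi>. \<Psi> \<in> S \<Longrightarrow> m (\<lambda>p. z * \<Psi> p) = z * m \<Psi>"
    "\<And>\<Psi>. \<Psi> \<in> S \<Longrightarrow> cmod (m \<Psi>) \<le> K * form_norm A \<Psi>"
    "\<And>\<Psi>. \<Psi> \<in> S \<Longrightarrow> m (form_of A (\<lambda>a b. \<Psi> (a \<otimes> b, u))) = \<Psi> (u, u)"
    "\<And>\<Psi> c. \<Psi> \<in> S \<Longrightarrow> c \<in> carrier A \<Longrightarrow>
       m (form_of A (\<lambda>a b. \<Psi> (c \<otimes> a, b))) - m (form_of A (\<lambda>a b. \<Psi> (a, b \<otimes> c))) =
       \<Psi> (u, c) - m (form_of A (\<lambda>a b. \<Psi> (a \<otimes> b, c)))"
proof -
  note SD = closed_form_spaceD[OF S]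
  note bil = bilinear_formsD[OF SD(1)]
  define E where "E = form_space A S"
  define l where "l = (\<lambda>c \<Psi>. form_of A (\<lambda>a b. \<Psi> (a, b \<otimes> c) - \<Psi> (a \<otimes> b, c)))"
  define r where "r = (\<lambda>\<Psi> c. form_of A (\<lambda>a b. \<Psi> (c \<otimes> a, b)))"
  define D where "D = (\<lambda>c \<Psi>. if \<Psi> \<in> S then \<Psi> (u, c) else 0)"
  have E: "carrier E = S" "vnorm E = form_norm A" "\<Psi> \<oplus>\<^bsub>E\<^esub> \<Phi> = (\<lambda>p. \<Psi> p + \<Phi> p)"
    "z \<odot>\<^bsub>E\<^esub> \<Psi> = (\<lambda>p. z * \<Psi> p)" for \<Psi> \<Phi> z
    by (simp_all add: E_def)
  have l_split: "l c \<Psi> = (\<lambda>p. form_of A (\<lambda>a b. \<Psi> (a, b \<otimes> c)) p + (-1) * form_of A (\<lambda>a b. \<Psi> (a \<otimes> b, c)) p)"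
    for c \<Psi>
    by (auto simp: l_def form_of_def)
  have l_closed: "l c \<Psi> \<in> S" if "\<Psi> \<in> S" "c \<in> carrier A" for c \<Psi>
    unfolding l_split by (intro SD(3,4) stable that)
  have bimod: "banach_bimodule A E l r"
    unfolding E_def l_def r_def
    by (rule form_bimodule[OF S stable(1) l_closed[unfolded l_def]])
  interpret E: banach_space E
    unfolding E_def by (rule form_space_banach[OF S])
  have D_bound: "cmod (D c \<Psi>) \<le> vnorm A u * vnorm A c * form_norm A \<Psi>"
    if "\<Psi> \<in> S" "c \<in> carrier A" for c \<Psi>
    using form_normD[OF SD(1)[OF that(1)] u(1) that(2)] that by (simp add: D_def algebra_simps)
  have D_dual: "D c \<in> carrier (dual_space E)" if c: "c \<in> carrier A" for c
    by (rule dual_spaceI[where K = "vnorm A u * vnorm A c"])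
      (simp_all add: E D_bound[OF _ c], simp_all add: D_def SD(3,4))
  have "vnorm (dual_space E) (D c) \<le> vnorm A u * vnorm A c" if c: "c \<in> carrier A" for c
  proof -
    have "(SUP \<Psi>\<in>{\<Psi>\<in>carrier E. vnorm E \<Psi> \<le> 1}. cmod (D c \<Psi>)) \<le> vnorm A u * vnorm A c"
    proof (rule cSUP_least)
      \<comment> \<open>A common bound controls the supremum only over a nonempty set; the zero form
        lies in the unit ball.\<close>
      have "form_norm A (\<lambda>p. 0) \<le> 0"
        by (rule form_norm_le) (auto simp: form_bound_def)
      then show "{\<Psi>\<in>carrier E. vnorm E \<Psi> \<le> 1} \<noteq> {}"
        using SD(2) by (auto simp: E intro!: exI[of _ "\<lambda>p. 0"])
      fix \<Psi> assume "\<Psi> \<in> {\<Psi>\<in>carrier E. vnorm E \<Psi> \<le> 1}"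
      then have "cmod (D c \<Psi>) \<le> vnorm A u * vnorm A c * form_norm A \<Psi>" "form_norm A \<Psi> \<le> 1"
        using D_bound c by (auto simp: E)
      moreover have "vnorm A u * vnorm A c * form_norm A \<Psi> \<le> vnorm A u * vnorm A c * 1"
        using calculation(2) u(1) c by (intro mult_left_mono mult_nonneg_nonneg vnorm_nonneg)
      ultimately show "cmod (D c \<Psi>) \<le> vnorm A u * vnorm A c" by simp
    qed
    then show ?thesis by (simp add: dual_space_def)
  qed
  moreover have "D (a \<oplus> b) = (\<lambda>\<Psi>. D a \<Psi> + D b \<Psi>)" if "a \<in> carrier A" "b \<in> carrier A" for a b
    using bil(3)[OF _ u(1) that] by (auto simp: D_def)
  moreover have "D (z \<odot> a) = (\<lambda>\<Psi>. z * D a \<Psi>)" if "a \<in> carrier A" for z a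
    using bil(5)[OF _ u(1) that] by (auto simp: D_def)
  \<comment> \<open>At a form in \<open>S\<close>, the left action contributes the value at (a, b),
    and the twisted right action contributes the value at (u, ab) minus the value at (a, b).\<close>
  moreover have "D (a \<otimes> b) = (\<lambda>\<Psi>. dual_left E r a (D b) \<Psi> + dual_right E l (D a) b \<Psi>)"
    if "a \<in> carrier A" "b \<in> carrier A" for a b
  proof
    fix \<Psi>
    show "D (a \<otimes> b) \<Psi> = dual_left E r a (D b) \<Psi> + dual_right E l (D a) b \<Psi>"
    proof (cases "\<Psi> \<in> S")
      case True
      have "D (a \<otimes> b) \<Psi> = \<Psi> (u, a \<otimes> b)" by (simp add: D_def True)
      moreover have "dual_left E r a (D b) \<Psi> = \<Psi> (a, b)"
        using stable(1)[OF True that(1)] that u by (simp add: D_def dual_left_def E r_def True)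
      moreover have "dual_right E l (D a) b \<Psi> = \<Psi> (u, a \<otimes> b) - \<Psi> (a, b)"
        using l_closed[OF True that(2)] that u by (simp add: D_def dual_right_def E True) (simp add: l_def)
      ultimately show ?thesis by simp
    qed (simp add: D_def dual_left_def dual_right_def E)
  qed
  ultimately have "bounded_derivation A (dual_space E) (dual_left E r) (dual_right E l) D"
    using D_dual unfolding bounded_derivation_def bounded_linear_map_def by auto
  then have "inner_derivation A (dual_space E) (dual_left E r) (dual_right E l) D"
    using amen bimod unfolding amenable_def by blast
  then obtain m where m: "m \<in> carrier (dual_space E)"
    and inner: "\<And>c. c \<in> carrier A \<Longrightarrow>
      D c = dual_left E r c m \<ominus>\<^bsub>dual_space E\<^esub> dual_right E l m c"
    unfolding inner_derivation_def by blast
  note mD = dual_spaceD[OF m, unfolded E]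
  obtain K where K: "\<And>\<Psi>. \<Psi> \<in> S \<Longrightarrow> cmod (m \<Psi>) \<le> K * form_norm A \<Psi>"
    using mD(4) by blast
  interpret bm: banach_bimodule A E l r by (rule bimod)
  have "D c = (\<lambda>\<Psi>. dual_left E r c m \<Psi> - dual_right E l m c \<Psi>)"
    if "c \<in> carrier A" for c
    using inner[OF that] pointwise_space_minus[OF E.pointwise_dual_space]
      bm.dual_left_closed[OF that m] bm.dual_right_closed[OF that m] by simp
  from fun_cong[OF this] have D_eq: "D c \<Psi> = m (r \<Psi> c) - m (l c \<Psi>)"
    if "c \<in> carrier A" "\<Psi> \<in> S" for c \<Psi>
    using that by (simp add: dual_left_def dual_right_def E)
  have l_eq: "m (l c \<Psi>) = m (form_of A (\<lambda>a b. \<Psi> (a, b \<otimes> c))) - m (form_of A (\<lambda>a b. \<Psi> (a \<otimes> b, c)))"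
    if "c \<in> carrier A" "\<Psi> \<in> S" for c \<Psi>
    unfolding l_split using that stable SD(4) by (simp only: mD(2) mD(3)) simp
  have main: "m (form_of A (\<lambda>a b. \<Psi> (c \<otimes> a, b))) - m (form_of A (\<lambda>a b. \<Psi> (a, b \<otimes> c))) =
       \<Psi> (u, c) - m (form_of A (\<lambda>a b. \<Psi> (a \<otimes> b, c)))" if "\<Psi> \<in> S" "c \<in> carrier A" for \<Psi> c
    using D_eq[OF that(2,1)] that(1) unfolding l_eq[OF that(2,1)] by (simp add: D_def r_def algebra_simps)
  have "form_of A (\<lambda>a b. \<Psi> (u \<otimes> a, b)) = form_of A (\<lambda>a b. \<Psi> (a, b \<otimes> u))" for \<Psi>
    by (rule form_eqI[of A]) (auto simp: form_of_outside u)
  then have unit: "m (form_of A (\<lambda>a b. \<Psi> (a \<otimes> b, u))) = \<Psi> (u, u)" if "\<Psi> \<in> S" for \<Psi>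
    using main[OF that u(1)] by simp
  show ?thesis
    by (rule that[OF mD(2) mD(3) K unit main])
qed

end

section \<open>The centre of the group algebra\<close>

lemma summable_on_nonneg_bounded:
  fixes h :: "'x \<Rightarrow> real"
  assumes "\<And>x. x \<in> S \<Longrightarrow> 0 \<le> h x" "\<And>F. finite F \<Longrightarrow> F \<subseteq> S \<Longrightarrow> sum h F \<le> K"
  shows "h summable_on S" "infsum h S \<le> K"
proof -
  show s: "h summable_on S"
    using assms by (intro nonneg_bdd_above_summable_on bdd_aboveI[of _ K]) auto
  show "infsum h S \<le> K"
    by (rule infsum_le_finite_sums[OF s assms(2)])
qed

lemma infsum_diff_finite_le:
  fixes h :: "'x \<Rightarrow> complex" and k :: "'x \<Rightarrow> real"
  assumes h: "h summable_on S" and Z: "finite Z" "Z \<subseteq> S"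
    and k: "k summable_on S - Z" "\<And>x. x \<in> S - Z \<Longrightarrow> cmod (h x) \<le> k x"
  shows "cmod (infsum h S - sum h Z) \<le> infsum k (S - Z)"
proof -
  have "infsum h (S - Z) = infsum h S - sum h Z"
    using infsum_Diff[OF h _ Z(2)] Z(1) by simp
  moreover have hk: "(\<lambda>x. cmod (h x)) summable_on S - Z"
    by (rule summable_on_comparison_test[OF k(1)]) (use k(2) in auto)
  have "cmod (infsum h (S - Z)) \<le> infsum (\<lambda>x. cmod (h x)) (S - Z)"
    by (rule norm_infsum_bound[OF hk])
  moreover have "infsum (\<lambda>x. cmod (h x)) (S - Z) \<le> infsum k (S - Z)"
    by (rule infsum_mono[OF hk k])
  ultimately show ?thesis by simp
qed

lemma summable_on_tail:
  fixes k :: "'x \<Rightarrow> real"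
  assumes "k summable_on S" "e > 0"
  obtains Z where "finite Z" "Z \<subseteq> S" "infsum k (S - Z) < e"
proof -
  have "(k has_sum infsum k S) S" using assms(1) by (rule has_sum_infsum)
  then have "\<forall>\<^sub>F Z in finite_subsets_at_top S. dist (sum k Z) (infsum k S) < e"
    using assms(2) by (simp add: has_sum_def tendsto_iff)
  then obtain Z where Z: "finite Z" "Z \<subseteq> S" "dist (sum k Z) (infsum k S) < e"
    by (auto simp: eventually_finite_subsets_at_top)
  have "infsum k (S - Z) = infsum k S - sum k Z"
    using infsum_Diff[OF assms(1) _ Z(2)] Z(1) by simp
  then show ?thesis
    using that Z by (simp add: dist_real_def)
qed

lemma has_sum_sum:
  fixes f :: "'i \<Rightarrow> 'x \<Rightarrow> 'b::topological_comm_monoid_add"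
  assumes "\<And>i. i \<in> F \<Longrightarrow> (f i has_sum s i) S"
  shows "((\<lambda>x. \<Sum>i\<in>F. f i x) has_sum (\<Sum>i\<in>F. s i)) S"
  using assms by (induction F rule: infinite_finite_induct) (auto intro: has_sum_add)

section \<open>Convolution of absolutely summable functions\<close>

context group
begin

abbreviation "L1 \<equiv> l1_algebra G"
abbreviation "ZL1 \<equiv> algebra_center (l1_algebra G)"

lemma l1_simps [simp]:
  "\<zero>\<^bsub>L1\<^esub> = (\<lambda>x. 0)" "f \<oplus>\<^bsub>L1\<^esub> g = (\<lambda>x. f x + g x)" "z \<odot>\<^bsub>L1\<^esub> f = (\<lambda>x. z * f x)"
  "vnorm L1 f = (\<Sum>\<^sub>\<infinity>x\<in>carrier G. cmod (f x))"
  by (simp_all add: l1_algebra_def)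

lemma l1_mult: "f \<otimes>\<^bsub>L1\<^esub> g = (\<lambda>x. if x \<in> carrier G
    then (\<Sum>\<^sub>\<infinity>y\<in>carrier G. f y * g (inv y \<otimes> x)) else 0)"
  by (simp add: l1_algebra_def)

lemma l1_carrier: "f \<in> carrier L1 \<longleftrightarrow>
    (\<forall>x. x \<notin> carrier G \<longrightarrow> f x = 0) \<and> (\<lambda>x. cmod (f x)) summable_on carrier G"
  by (simp add: l1_algebra_def)

lemma l1_nonneg: "0 \<le> vnorm L1 f"
  by (simp add: infsum_nonneg)

lemma l1_finite_sum_le:
  assumes "f \<in> carrier L1" "finite F" "F \<subseteq> carrier G"
  shows "(\<Sum>x\<in>F. cmod (f x)) \<le> vnorm L1 f"
  using assms by (simp add: l1_carrier finite_sum_le_infsum)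

lemma l1_eval_le: "f \<in> carrier L1 \<Longrightarrow> cmod (f x) \<le> vnorm L1 f"
  using l1_finite_sum_le[of f "{x}"] l1_nonneg[of f] by (cases "x \<in> carrier G") (auto simp: l1_carrier)

lemma bij_betw_shift: "y \<in> carrier G \<Longrightarrow> bij_betw (\<lambda>x. inv y \<otimes> x) (carrier G) (carrier G)"
  by (rule bij_betwI[where g = "\<lambda>x. y \<otimes> x"]) (auto simp: m_assoc[symmetric])

lemma l1_shift_summable:
  "f \<in> carrier L1 \<Longrightarrow> y \<in> carrier G \<Longrightarrow> (\<lambda>x. cmod (f (inv y \<otimes> x))) summable_on carrier G"
  using summable_on_reindex_bij_betw[OF bij_betw_shift, of y "\<lambda>x. cmod (f x)"]
  by (simp add: l1_carrier)

lemma l1_shift_infsum: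
  "y \<in> carrier G \<Longrightarrow> (\<Sum>\<^sub>\<infinity>x\<in>carrier G. cmod (f (inv y \<otimes> x))) = vnorm L1 f"
  using infsum_reindex_bij_betw[OF bij_betw_shift, of y "\<lambda>x. cmod (f x)"] by simp

lemma l1_conv_summable:
  assumes "f \<in> carrier L1" "g \<in> carrier L1"
  shows "(\<lambda>y. cmod (f y * g (inv y \<otimes> x))) summable_on carrier G"
proof (rule summable_on_comparison_test)
  show "(\<lambda>y. cmod (f y) * vnorm L1 g) summable_on carrier G"
    using assms by (intro summable_on_cmult_left) (simp add: l1_carrier)
  show "cmod (f y * g (inv y \<otimes> x)) \<le> cmod (f y) * vnorm L1 g" for y
    unfolding norm_mult by (intro mult_left_mono l1_eval_le assms) auto
qed auto

text \<open>Summing over \<open>x\<close> first, translation invariance turns the inner sum into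
  \<open>cmod (f y) * vnorm L1 g\<close>, which is summable in \<open>y\<close>.\<close>

lemma l1_conv_prod_summable:
  assumes "f \<in> carrier L1" "g \<in> carrier L1"
  shows "(\<lambda>p. norm (case p of (y, x) \<Rightarrow> f y * g (inv y \<otimes> x))) summable_on (carrier G \<times> carrier G)"
proof (subst Infinite_Sum.abs_summable_on_Sigma_iff, intro conjI ballI)
  fix y assume y: "y \<in> carrier G"
  show "(\<lambda>x. norm (case (y, x) of (y, x) \<Rightarrow> f y * g (inv y \<otimes> x))) summable_on carrier G"
    using l1_shift_summable[OF assms(2) y] by (simp add: norm_mult summable_on_cmult_right)
next
  have "(\<lambda>y. \<Sum>\<^sub>\<infinity>x\<in>carrier G. cmod (f y * g (inv y \<otimes> x))) summable_on carrier G \<longleftrightarrow>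
      (\<lambda>y. cmod (f y) * vnorm L1 g) summable_on carrier G"
    by (rule summable_on_cong) (simp add: norm_mult infsum_cmult_right' l1_shift_infsum del: l1_simps)
  moreover have "(\<lambda>y. cmod (f y) * vnorm L1 g) summable_on carrier G"
    using assms by (intro summable_on_cmult_left) (simp add: l1_carrier)
  ultimately show "(\<lambda>y. norm (\<Sum>\<^sub>\<infinity>x\<in>carrier G. norm (case (y, x) of (y, x) \<Rightarrow> f y * g (inv y \<otimes> x))))
      summable_on carrier G"
    by (simp add: infsum_nonneg)
qed

text \<open>For a finite set of points \<open>x\<close> the sum moves inside the convolution, and
  translation invariance bounds it by the product of the norms. This uniform bound on partial sums
  yields summability and the norm inequality together.\<close>

lemma l1_mult_closed:
  assumes f: "f \<in> carrier L1" and g: "g \<in> carrier L1"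
  shows "f \<otimes>\<^bsub>L1\<^esub> g \<in> carrier L1" "vnorm L1 (f \<otimes>\<^bsub>L1\<^esub> g) \<le> vnorm L1 f * vnorm L1 g"
proof -
  have bound: "(\<Sum>x\<in>F. cmod ((f \<otimes>\<^bsub>L1\<^esub> g) x)) \<le> vnorm L1 f * vnorm L1 g"
    if F: "finite F" "F \<subseteq> carrier G" for F
  proof -
    have "(\<Sum>x\<in>F. cmod ((f \<otimes>\<^bsub>L1\<^esub> g) x)) \<le> (\<Sum>x\<in>F. \<Sum>\<^sub>\<infinity>y\<in>carrier G. cmod (f y * g (inv y \<otimes> x)))"
      using F by (intro sum_mono) (auto simp: l1_mult intro!: norm_infsum_bound l1_conv_summable f g)
    also have "\<dots> = (\<Sum>\<^sub>\<infinity>y\<in>carrier G. \<Sum>x\<in>F. cmod (f y * g (inv y \<otimes> x)))"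
      by (intro infsumI[symmetric] has_sum_sum has_sum_infsum l1_conv_summable f g)
    also have "\<dots> \<le> (\<Sum>\<^sub>\<infinity>y\<in>carrier G. cmod (f y) * vnorm L1 g)"
    proof (rule infsum_mono)
      show "(\<lambda>y. \<Sum>x\<in>F. cmod (f y * g (inv y \<otimes> x))) summable_on carrier G"
        by (rule has_sum_imp_summable[OF has_sum_sum[OF has_sum_infsum[OF l1_conv_summable[OF f g]]]])
      show "(\<lambda>y. cmod (f y) * vnorm L1 g) summable_on carrier G"
        using f by (intro summable_on_cmult_left) (simp add: l1_carrier)
      fix y assume y: "y \<in> carrier G"
      have "(\<Sum>x\<in>F. cmod (g (inv y \<otimes> x))) \<le> vnorm L1 g"
        using finite_sum_le_infsum[OF l1_shift_summable[OF g y] F] l1_shift_infsum[OF y, of g]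
        by simp
      then show "(\<Sum>x\<in>F. cmod (f y * g (inv y \<otimes> x))) \<le> cmod (f y) * vnorm L1 g"
        unfolding norm_mult sum_distrib_left[symmetric] by (rule mult_left_mono) simp
    qed
    also have "\<dots> = vnorm L1 f * vnorm L1 g"
      by (simp add: infsum_cmult_left')
    finally show ?thesis .
  qed
  note * = summable_on_nonneg_bounded[of "carrier G" "\<lambda>x. cmod ((f \<otimes>\<^bsub>L1\<^esub> g) x)", OF norm_ge_zero bound]
  show "f \<otimes>\<^bsub>L1\<^esub> g \<in> carrier L1"
    using *(1) by (simp add: l1_carrier l1_mult)
  show "vnorm L1 (f \<otimes>\<^bsub>L1\<^esub> g) \<le> vnorm L1 f * vnorm L1 g"
    using *(2) by simp
qed

lemma l1_mult_assoc:
  assumes f: "f \<in> carrier L1" and g: "g \<in> carrier L1" and h: "h \<in> carrier L1"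
  shows "(f \<otimes>\<^bsub>L1\<^esub> g) \<otimes>\<^bsub>L1\<^esub> h = f \<otimes>\<^bsub>L1\<^esub> (g \<otimes>\<^bsub>L1\<^esub> h)"
proof
  fix x
  show "((f \<otimes>\<^bsub>L1\<^esub> g) \<otimes>\<^bsub>L1\<^esub> h) x = (f \<otimes>\<^bsub>L1\<^esub> (g \<otimes>\<^bsub>L1\<^esub> h)) x"
  proof (cases "x \<in> carrier G")
    case x: True
    let ?G = "carrier G"
    let ?F = "\<lambda>z y. f z * g (inv z \<otimes> y) * h (inv y \<otimes> x)"
    \<comment> \<open>The terms are dominated by those of the convolution of \<open>f\<close> and
      \<open>g\<close>, times the constant \<open>vnorm L1 h\<close>; this justifies exchanging the
      two sums.\<close>
    have "(\<lambda>p. norm (case p of (z, y) \<Rightarrow> ?F z y)) summable_on (?G \<times> ?G)"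
    proof (rule summable_on_comparison_test)
      show "(\<lambda>p. cmod (case p of (z, y) \<Rightarrow> f z * g (inv z \<otimes> y)) * vnorm L1 h) summable_on ?G \<times> ?G"
        by (intro summable_on_cmult_left l1_conv_prod_summable f g)
      show "norm (case p of (z, y) \<Rightarrow> ?F z y) \<le>
          cmod (case p of (z, y) \<Rightarrow> f z * g (inv z \<otimes> y)) * vnorm L1 h" for p
        using l1_eval_le[OF h] by (cases p) (auto simp: norm_mult simp del: l1_simps intro!: mult_left_mono)
    qed auto
    then have swap: "(\<Sum>\<^sub>\<infinity>z\<in>?G. \<Sum>\<^sub>\<infinity>y\<in>?G. ?F z y) = (\<Sum>\<^sub>\<infinity>y\<in>?G. \<Sum>\<^sub>\<infinity>z\<in>?G. ?F z y)"
      by (rule infsum_swap_banach[where f = ?F, OF abs_summable_summable])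
    have "((f \<otimes>\<^bsub>L1\<^esub> g) \<otimes>\<^bsub>L1\<^esub> h) x = (\<Sum>\<^sub>\<infinity>y\<in>?G. \<Sum>\<^sub>\<infinity>z\<in>?G. ?F z y)"
      by (auto simp: l1_mult x infsum_cmult_left' intro!: infsum_cong)
    also have "\<dots> = (\<Sum>\<^sub>\<infinity>z\<in>?G. f z * (\<Sum>\<^sub>\<infinity>y\<in>?G. g (inv z \<otimes> y) * h (inv y \<otimes> x)))"
      unfolding swap[symmetric] by (simp add: infsum_cmult_right' mult.assoc)
    also have "\<dots> = (f \<otimes>\<^bsub>L1\<^esub> (g \<otimes>\<^bsub>L1\<^esub> h)) x"
    proof -
      \<comment> \<open>The substitution is \<open>w = inv z \<otimes> y\<close>, for which
        \<open>inv w \<otimes> (inv z \<otimes> x) = inv y \<otimes> x\<close>.\<close>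
      have "(\<Sum>\<^sub>\<infinity>y\<in>?G. g (inv z \<otimes> y) * h (inv y \<otimes> x)) = (\<Sum>\<^sub>\<infinity>w\<in>?G. g w * h (inv w \<otimes> (inv z \<otimes> x)))"
        if z: "z \<in> ?G" for z
      proof -
        have "g (inv z \<otimes> y) * h (inv y \<otimes> x) =
            g (inv z \<otimes> y) * h (inv (inv z \<otimes> y) \<otimes> (inv z \<otimes> x))" if "y \<in> ?G" for y
        proof -
          have "z \<otimes> (inv z \<otimes> x) = x" using z x by (simp add: m_assoc[symmetric])
          then show ?thesis using that z x by (simp add: inv_mult_group m_assoc)
        qed
        then have "(\<Sum>\<^sub>\<infinity>y\<in>?G. g (inv z \<otimes> y) * h (inv y \<otimes> x)) =
            (\<Sum>\<^sub>\<infinity>y\<in>?G. g (inv z \<otimes> y) * h (inv (inv z \<otimes> y) \<otimes> (inv z \<otimes> x)))"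
          by (rule infsum_cong)
        also have "\<dots> = (\<Sum>\<^sub>\<infinity>w\<in>?G. g w * h (inv w \<otimes> (inv z \<otimes> x)))"
          by (rule infsum_reindex_bij_betw[OF bij_betw_shift[OF z]])
        finally show ?thesis .
      qed
      then show ?thesis
        by (auto simp: l1_mult x intro!: infsum_cong)
    qed
    finally show ?thesis .
  qed (simp add: l1_mult)
qed

section \<open>Centrality as invariance under conjugation\<close>

lemma delta_l1: "(\<lambda>x. if x = t then 1 else 0) \<in> carrier L1" if "t \<in> carrier G"
proof -
  have "(\<lambda>x. cmod (if x = t then 1 else 0)) summable_on carrier G"
    by (rule finite_nonzero_values_imp_summable_on) (auto intro: finite_subset[of _ "{t}"])
  then show ?thesis using that by (auto simp: l1_carrier)
qed

text \<open>Commuting with the point mass at \<open>t\<close>, evaluated at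
  \<open>t \<otimes> x\<close>, compares the values of \<open>f\<close> at a conjugate of
  \<open>x\<close> and at \<open>x\<close>. Conversely, for a class function the substitution of
  \<open>x \<otimes> inv y\<close> for \<open>y\<close> turns one convolution into the
  other.\<close>

lemma center_carrier:
  "carrier ZL1 = {f \<in> carrier L1. \<forall>t\<in>carrier G. \<forall>x\<in>carrier G. f (t \<otimes> x \<otimes> inv t) = f x}"
proof (intro equalityI subsetI)
  fix f assume "f \<in> carrier ZL1"
  then have f: "f \<in> carrier L1" "\<And>a. a \<in> carrier L1 \<Longrightarrow> f \<otimes>\<^bsub>L1\<^esub> a = a \<otimes>\<^bsub>L1\<^esub> f"
    by (auto simp: algebra_center_def)
  have "f (t \<otimes> x \<otimes> inv t) = f x" if t: "t \<in> carrier G" and x: "x \<in> carrier G" for t x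
  proof -
    let ?\<delta> = "\<lambda>x. if x = t then 1 else 0 :: complex"
    have "inv y \<otimes> (t \<otimes> x) = t \<longleftrightarrow> y = t \<otimes> x \<otimes> inv t" if y: "y \<in> carrier G" for y
      using y t x by (metis inv_closed inv_inv inv_solve_left inv_solve_right m_closed)
    then have "(f \<otimes>\<^bsub>L1\<^esub> ?\<delta>) (t \<otimes> x) = (\<Sum>\<^sub>\<infinity>y\<in>carrier G. if y = t \<otimes> x \<otimes> inv t then f y else 0)"
      using t x by (auto simp: l1_mult intro!: infsum_cong)
    also have "\<dots> = f (t \<otimes> x \<otimes> inv t)"
      using t x by (intro infsumI has_sum_finite_neutralI[where B = "{t \<otimes> x \<otimes> inv t}"]) auto
    finally have 1: "(f \<otimes>\<^bsub>L1\<^esub> ?\<delta>) (t \<otimes> x) = f (t \<otimes> x \<otimes> inv t)" .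
    have "(?\<delta> \<otimes>\<^bsub>L1\<^esub> f) (t \<otimes> x) = f x"
      using t x
      by (simp add: l1_mult)
        (intro infsumI has_sum_finite_neutralI[where B = "{t}"], auto simp: m_assoc[symmetric])
    with 1 show ?thesis using f(2)[OF delta_l1[OF t]] by simp
  qed
  with f(1) show "f \<in> {f \<in> carrier L1. \<forall>t\<in>carrier G. \<forall>x\<in>carrier G. f (t \<otimes> x \<otimes> inv t) = f x}" by blast
next
  fix f assume "f \<in> {f \<in> carrier L1. \<forall>t\<in>carrier G. \<forall>x\<in>carrier G. f (t \<otimes> x \<otimes> inv t) = f x}"
  then have f: "f \<in> carrier L1"
    and conj: "\<And>t x. t \<in> carrier G \<Longrightarrow> x \<in> carrier G \<Longrightarrow> f (t \<otimes> x \<otimes> inv t) = f x" by auto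
  have "f \<otimes>\<^bsub>L1\<^esub> a = a \<otimes>\<^bsub>L1\<^esub> f" for a
  proof
    fix x
    show "(f \<otimes>\<^bsub>L1\<^esub> a) x = (a \<otimes>\<^bsub>L1\<^esub> f) x"
    proof (cases "x \<in> carrier G")
      case x: True
      have bij: "bij_betw (\<lambda>y. x \<otimes> inv y) (carrier G) (carrier G)"
        by (rule bij_betwI[where g = "\<lambda>y. inv y \<otimes> x"]) 
          (use x in \<open>simp_all add: Pi_iff inv_mult_group m_assoc\<close>, simp add: m_assoc[symmetric])
      have "(\<Sum>\<^sub>\<infinity>y\<in>carrier G. a y * f (inv y \<otimes> x)) =
          (\<Sum>\<^sub>\<infinity>y\<in>carrier G. f (x \<otimes> inv y) * a (inv (x \<otimes> inv y) \<otimes> x))"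
      proof (rule infsum_cong)
        fix y assume y: "y \<in> carrier G"
        \<comment> \<open>The two arguments are conjugate by \<open>y\<close>.\<close>
        have "f (inv y \<otimes> x) = f (x \<otimes> inv y)"
          using conj[of y "inv y \<otimes> x"] x y by (simp add: m_assoc[symmetric])
        moreover have "inv (x \<otimes> inv y) \<otimes> x = y"
          using x y by (simp add: inv_mult_group m_assoc)
        ultimately show "a y * f (inv y \<otimes> x) = f (x \<otimes> inv y) * a (inv (x \<otimes> inv y) \<otimes> x)" by simp
      qed
      also have "\<dots> = (\<Sum>\<^sub>\<infinity>y\<in>carrier G. f y * a (inv y \<otimes> x))"
        by (rule infsum_reindex_bij_betw[OF bij])
      finally show ?thesis using x by (simp add: l1_mult)
    qed (simp add: l1_mult)
  qed
  with f show "f \<in> carrier ZL1" by (simp add: algebra_center_def)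
qed

lemma center_simps [simp]:
  "\<zero>\<^bsub>ZL1\<^esub> = (\<lambda>x. 0)" "f \<oplus>\<^bsub>ZL1\<^esub> g = (\<lambda>x. f x + g x)" "z \<odot>\<^bsub>ZL1\<^esub> f = (\<lambda>x. z * f x)"
  "vnorm ZL1 = vnorm L1" "f \<otimes>\<^bsub>ZL1\<^esub> g = f \<otimes>\<^bsub>L1\<^esub> g"
  by (simp_all add: algebra_center_def)

lemma center_l1: "f \<in> carrier ZL1 \<Longrightarrow> f \<in> carrier L1"
  by (simp add: algebra_center_def)

lemma center_conj:
  "f \<in> carrier ZL1 \<Longrightarrow> t \<in> carrier G \<Longrightarrow> x \<in> carrier G \<Longrightarrow> f (t \<otimes> x \<otimes> inv t) = f x"
  by (simp add: center_carrier)

lemma center_commute: "f \<in> carrier ZL1 \<Longrightarrow> g \<in> carrier L1 \<Longrightarrow> f \<otimes>\<^bsub>L1\<^esub> g = g \<otimes>\<^bsub>L1\<^esub> f"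
  by (simp add: algebra_center_def)

section \<open>The centre as a Banach algebra\<close>

lemma l1_add:
  assumes f: "f \<in> carrier L1" and g: "g \<in> carrier L1"
  shows "(\<lambda>x. f x + g x) \<in> carrier L1" "vnorm L1 (\<lambda>x. f x + g x) \<le> vnorm L1 f + vnorm L1 g"
proof -
  have s: "(\<lambda>x. cmod (f x) + cmod (g x)) summable_on carrier G"
    using f g by (intro summable_on_add) (auto simp: l1_carrier)
  have s': "(\<lambda>x. cmod (f x + g x)) summable_on carrier G"
    by (rule summable_on_comparison_test[OF s]) (auto simp: norm_triangle_ineq)
  then show "(\<lambda>x. f x + g x) \<in> carrier L1"
    using f g by (auto simp: l1_carrier)
  have "infsum (\<lambda>x. cmod (f x + g x)) (carrier G) \<le> infsum (\<lambda>x. cmod (f x) + cmod (g x)) (carrier G)"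
    by (rule infsum_mono[OF s' s]) (rule norm_triangle_ineq)
  then show "vnorm L1 (\<lambda>x. f x + g x) \<le> vnorm L1 f + vnorm L1 g"
    using f g by (simp add: infsum_add l1_carrier)
qed

lemma l1_scale:
  assumes "f \<in> carrier L1"
  shows "(\<lambda>x. z * f x) \<in> carrier L1" "vnorm L1 (\<lambda>x. z * f x) = cmod z * vnorm L1 f"
  using assms by (auto simp: l1_carrier norm_mult summable_on_cmult_right infsum_cmult_right')

lemma pointwise_center: "pointwise_space ZL1"
proof -
  have "add ZL1 = (\<lambda>f g x. f x + g x)" "smult ZL1 = (\<lambda>c f x. c * f x)"
    by (simp_all add: algebra_center_def l1_algebra_def)
  moreover have "(\<lambda>x. 0) \<in> carrier ZL1" by (simp add: center_carrier l1_carrier)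
  moreover have "(\<lambda>x. f x + g x) \<in> carrier ZL1" if "f \<in> carrier ZL1" "g \<in> carrier ZL1" for f g
    using that l1_add(1)[of f g] by (simp add: center_carrier)
  moreover have "(\<lambda>x. z * f x) \<in> carrier ZL1" if "f \<in> carrier ZL1" for z f
    using that l1_scale(1)[of f z] by (simp add: center_carrier)
  ultimately show ?thesis by (simp add: pointwise_space_def)
qed

text \<open>A conjugation identity and a finite partial sum of the norm involve finitely many
  points, so both pass to the limit. The centre can therefore be its own ambient set
  \<open>T\<close> in \<open>pointwise_space_banach\<close>.\<close>

lemma center_limit:
  assumes s: "\<And>n::nat. s n \<in> carrier ZL1" and K: "\<And>n. vnorm L1 (s n) \<le> K"
    and lim: "\<And>x. (\<lambda>n. s n x) \<longlonglongrightarrow> f x"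
  shows "f \<in> carrier ZL1 \<and> vnorm L1 f \<le> K"
proof -
  have "(\<Sum>x\<in>F. cmod (f x)) \<le> K" if F: "finite F" "F \<subseteq> carrier G" for F
  proof (rule Lim_bounded)
    show "(\<lambda>n. \<Sum>x\<in>F. cmod (s n x)) \<longlonglongrightarrow> (\<Sum>x\<in>F. cmod (f x))"
      by (intro tendsto_sum tendsto_norm lim)
    show "\<forall>n\<ge>0. (\<Sum>x\<in>F. cmod (s n x)) \<le> K"
      using order_trans[OF l1_finite_sum_le[OF center_l1[OF s] F] K] by blast
  qed
  note * = summable_on_nonneg_bounded[of "carrier G" "\<lambda>x. cmod (f x)", OF norm_ge_zero this]
  have "f x = 0" if "x \<notin> carrier G" for x
    using center_l1[OF s] that by (intro LIMSEQ_unique[OF lim]) (simp add: l1_carrier)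
  moreover have "f (t \<otimes> x \<otimes> inv t) = f x" if "t \<in> carrier G" "x \<in> carrier G" for t x
    using lim[of x] center_conj[OF s that] by (intro LIMSEQ_unique[OF lim]) simp
  ultimately show ?thesis
    using * by (auto simp: center_carrier l1_carrier)
qed

lemma center_mult_closed:
  assumes f: "f \<in> carrier ZL1" and g: "g \<in> carrier ZL1"
  shows "f \<otimes>\<^bsub>L1\<^esub> g \<in> carrier ZL1"
proof -
  have "(f \<otimes>\<^bsub>L1\<^esub> g) \<otimes>\<^bsub>L1\<^esub> a = a \<otimes>\<^bsub>L1\<^esub> (f \<otimes>\<^bsub>L1\<^esub> g)" if a: "a \<in> carrier L1" for a
    using f g a by (metis center_commute center_l1 l1_mult_assoc)
  with l1_mult_closed(1)[OF center_l1[OF f] center_l1[OF g]] show ?thesis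
    unfolding algebra_center_def by fastforce
qed

lemma l1_mult_add_right:
  assumes f: "f \<in> carrier L1" and g: "g \<in> carrier L1" and h: "h \<in> carrier L1"
  shows "f \<otimes>\<^bsub>L1\<^esub> (\<lambda>x. g x + h x) = (\<lambda>x. (f \<otimes>\<^bsub>L1\<^esub> g) x + (f \<otimes>\<^bsub>L1\<^esub> h) x)"
  using abs_summable_summable[OF l1_conv_summable[OF f g]] abs_summable_summable[OF l1_conv_summable[OF f h]]
  by (auto simp: l1_mult distrib_left infsum_add)

lemma l1_mult_scale_right: "f \<otimes>\<^bsub>L1\<^esub> (\<lambda>x. z * g x) = (\<lambda>x. z * (f \<otimes>\<^bsub>L1\<^esub> g) x)"
  by (auto simp: l1_mult mult.left_commute infsum_cmult_right')

lemma center_banach_algebra: "banach_algebra ZL1"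
proof -
  interpret banach_space ZL1
  proof (rule pointwise_space_banach[OF pointwise_center, where T = "carrier ZL1"], unfold center_simps)
    show "\<exists>k. \<forall>f\<in>carrier ZL1. cmod (f x) \<le> k * vnorm L1 f" for x
      using l1_eval_le[OF center_l1] by (intro exI[of _ 1]) (simp del: l1_simps)
    show "f \<in> carrier ZL1 \<and> vnorm L1 f \<le> K"
      if "\<And>n::nat. s n \<in> carrier ZL1" "\<And>n. vnorm L1 (s n) \<le> K" "\<And>x. (\<lambda>n. s n x) \<longlonglongrightarrow> f x" for s f K
      using that by (rule center_limit)
  qed (simp_all only: order_refl l1_nonneg center_l1 l1_add(2) l1_scale(2))
  note closed = pointwise_spaceD(5,6)[OF pointwise_center]
  show ?thesis
  proof (unfold_locales, unfold center_simps)
    fix a b c z assume a: "a \<in> carrier ZL1" and b: "b \<in> carrier ZL1"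
    show "a \<otimes>\<^bsub>L1\<^esub> b \<in> carrier ZL1" by (rule center_mult_closed[OF a b])
    show "vnorm L1 (a \<otimes>\<^bsub>L1\<^esub> b) \<le> vnorm L1 a * vnorm L1 b"
      by (intro l1_mult_closed center_l1 a b)
    show "a \<otimes>\<^bsub>L1\<^esub> (\<lambda>x. z * b x) = (\<lambda>x. z * (a \<otimes>\<^bsub>L1\<^esub> b) x)" by (rule l1_mult_scale_right)
    \<comment> \<open>Centrality reduces the laws for the left factor to those for the right
      factor.\<close>
    show "(\<lambda>x. z * a x) \<otimes>\<^bsub>L1\<^esub> b = (\<lambda>x. z * (a \<otimes>\<^bsub>L1\<^esub> b) x)"
      unfolding center_commute[OF closed(2)[OF a] center_l1[OF b]] center_commute[OF a center_l1[OF b]]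
      by (rule l1_mult_scale_right)
    assume c: "c \<in> carrier ZL1"
    show "(a \<otimes>\<^bsub>L1\<^esub> b) \<otimes>\<^bsub>L1\<^esub> c = a \<otimes>\<^bsub>L1\<^esub> (b \<otimes>\<^bsub>L1\<^esub> c)"
      by (intro l1_mult_assoc center_l1 a b c)
    show "a \<otimes>\<^bsub>L1\<^esub> (\<lambda>x. b x + c x) = (\<lambda>x. (a \<otimes>\<^bsub>L1\<^esub> b) x + (a \<otimes>\<^bsub>L1\<^esub> c) x)"
      by (intro l1_mult_add_right center_l1 a b c)
    show "(\<lambda>x. a x + b x) \<otimes>\<^bsub>L1\<^esub> c = (\<lambda>x. (a \<otimes>\<^bsub>L1\<^esub> c) x + (b \<otimes>\<^bsub>L1\<^esub> c) x)"
      unfolding center_commute[OF closed(1)[OF a b] center_l1[OF c]]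
        center_commute[OF a center_l1[OF c]] center_commute[OF b center_l1[OF c]]
      by (intro l1_mult_add_right center_l1 a b c)
  qed
qed

end

section \<open>Groups with finitely many conjugacy classes of each size\<close>

text \<open>Finiteness is demanded of elements rather than of classes, the form in which tails of
  convolutions use it. Since the group is infinite, it also forces arbitrarily large
  classes.\<close>

locale small_class_group = group G for G (structure) +
  assumes infinite_carrier: "infinite (carrier G)"
    and finite_class: "x \<in> carrier G \<Longrightarrow> finite (conj_class G x)"
    and finite_small_classes: "finite {x \<in> carrier G. card (conj_class G x) \<le> n}"
begin

sublocale ZL: banach_algebra ZL1
  by (rule center_banach_algebra)

section \<open>Class sizes and the decay of class functions\<close>

lemma conj_class_subset: "g \<in> carrier G \<Longrightarrow> conj_class G g \<subseteq> carrier G"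
  by (auto simp: conj_class_def)

lemma large_class: "\<exists>g\<in>carrier G. n < card (conj_class G g)"
proof (rule ccontr)
  assume "\<not> ?thesis"
  then have "carrier G = {x \<in> carrier G. card (conj_class G x) \<le> n}"
    by (auto simp: not_less)
  then show False
    using infinite_carrier finite_small_classes[of n] by simp
qed

lemma conj_class_closed:
  assumes g: "g \<in> carrier G" and t: "t \<in> carrier G" and x: "x \<in> conj_class G g"
  shows "t \<otimes> x \<otimes> inv t \<in> conj_class G g"
proof -
  obtain h where h: "h \<in> carrier G" "x = h \<otimes> g \<otimes> inv h"
    using x by (auto simp: conj_class_def)
  have "t \<otimes> x \<otimes> inv t = (t \<otimes> h) \<otimes> g \<otimes> inv (t \<otimes> h)"
    using h g t by (simp add: inv_mult_group m_assoc)
  then show ?thesis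
    using h(1) t unfolding conj_class_def by blast
qed

lemma class_function_bound:
  assumes f: "f \<in> carrier ZL1" and x: "x \<in> carrier G"
  shows "real (card (conj_class G x)) * cmod (f x) \<le> vnorm L1 f"
proof -
  have "f w = f x" if "w \<in> conj_class G x" for w
    using that center_conj[OF f _ x] by (auto simp: conj_class_def)
  then have "real (card (conj_class G x)) * cmod (f x) = (\<Sum>w\<in>conj_class G x. cmod (f w))"
    by simp
  also have "\<dots> \<le> vnorm L1 f"
    by (rule l1_finite_sum_le[OF center_l1[OF f] finite_class[OF x] conj_class_subset[OF x]])
  finally show ?thesis .
qed

text \<open>The size condition fails for finitely many points only, so class functions decay at a
  rate that depends on nothing but their norm. A size exceeding \<open>n\<close> is at least
  \<open>Suc n\<close>, which is a nonzero divisor even for \<open>n = 0\<close>.\<close>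

lemma class_function_small:
  assumes f: "f \<in> carrier ZL1" and x: "x \<in> carrier G" "n < card (conj_class G x)"
  shows "cmod (f x) \<le> vnorm L1 f * inverse (real (Suc n))"
proof -
  have "real (Suc n) * cmod (f x) \<le> real (card (conj_class G x)) * cmod (f x)"
    by (rule mult_right_mono) (use x(2) in auto)
  also have "\<dots> \<le> vnorm L1 f" by (rule class_function_bound[OF f x(1)])
  finally show ?thesis by (simp add: field_simps del: l1_simps)
qed

text \<open>Averaging the invariance of \<open>M\<close> over its first argument gives
  \<open>|C| B(y) = (\<Sum>z\<in>C. B (z\<^sup>-\<^sup>1 y))\<close> for the column sums \<open>B\<close> of \<open>M\<close> and every class \<open>C\<close>, so that \<open>B\<close>
  vanishes because \<open>|C|\<close> is unbounded.\<close>

lemma no_diagonal_kernel: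
  fixes M :: "'a \<Rightarrow> 'a \<Rightarrow> complex"
  assumes M: "(\<lambda>p. norm (case p of (x, y) \<Rightarrow> M x y)) summable_on carrier G \<times> carrier G"
    and diagonal: "\<And>x. x \<in> carrier G \<Longrightarrow>
      (\<Sum>\<^sub>\<infinity>z\<in>carrier G. M z (inv z \<otimes> x)) = (if x = \<one> then 1 else 0)"
    and invariant: "\<And>g x y. g \<in> carrier G \<Longrightarrow> x \<in> carrier G \<Longrightarrow> y \<in> carrier G \<Longrightarrow>
      (\<Sum>z\<in>conj_class G g. M (inv z \<otimes> x) y) = (\<Sum>z\<in>conj_class G g. M x (inv z \<otimes> y))"
  shows False
proof -
  let ?G = "carrier G"
  have M_swap: "(\<lambda>p. norm (case p of (y, x) \<Rightarrow> M x y)) summable_on ?G \<times> ?G"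
    using M by (subst (asm) summable_on_swap) (simp add: case_prod_unfold)
  note M_swap' = M_swap[THEN Infinite_Sum.abs_summable_on_Sigma_iff[THEN iffD1]]
  define B where "B = (\<lambda>y. \<Sum>\<^sub>\<infinity>x\<in>?G. M x y)"
  have col: "(\<lambda>x. norm (M x y)) summable_on ?G" if "y \<in> ?G" for y
    using M_swap' that by simp
  have B_summable: "(\<lambda>y. norm (B y)) summable_on ?G"
  proof (rule summable_on_comparison_test)
    show "(\<lambda>y. \<Sum>\<^sub>\<infinity>x\<in>?G. norm (M x y)) summable_on ?G"
      using M_swap' by (simp add: infsum_nonneg)
    show "norm (B y) \<le> (\<Sum>\<^sub>\<infinity>x\<in>?G. norm (M x y))" if "y \<in> ?G" for y
      unfolding B_def by (rule norm_infsum_bound[OF col[OF that]])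
  qed auto
  have B_class: "of_nat (card (conj_class G g)) * B y = (\<Sum>z\<in>conj_class G g. B (inv z \<otimes> y))"
    if g: "g \<in> ?G" and y: "y \<in> ?G" for g y
  proof -
    note C = subsetD[OF conj_class_subset[OF g]]
    \<comment> \<open>Left translation permutes the group, so every translated column keeps the sum
      \<open>B y\<close>.\<close>
    have "((\<lambda>x. \<Sum>z\<in>conj_class G g. M (inv z \<otimes> x) y) has_sum (\<Sum>z\<in>conj_class G g. B y)) ?G"
    proof (rule has_sum_sum)
      fix z assume "z \<in> conj_class G g"
      then have z: "z \<in> ?G" by (rule C)
      have "((\<lambda>x. M x y) has_sum B y) ?G"
        unfolding B_def by (rule has_sum_infsum[OF abs_summable_summable[OF col[OF y]]])
      then show "((\<lambda>x. M (inv z \<otimes> x) y) has_sum B y) ?G"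
        by (simp add: has_sum_reindex_bij_betw[OF bij_betw_shift[OF z], of "\<lambda>x. M x y"])
    qed
    moreover have "((\<lambda>x. \<Sum>z\<in>conj_class G g. M x (inv z \<otimes> y)) has_sum
        (\<Sum>z\<in>conj_class G g. B (inv z \<otimes> y))) ?G"
    proof (rule has_sum_sum)
      fix z assume "z \<in> conj_class G g"
      then have "inv z \<otimes> y \<in> ?G" using C y by simp
      then show "((\<lambda>x. M x (inv z \<otimes> y)) has_sum B (inv z \<otimes> y)) ?G"
        unfolding B_def by (intro has_sum_infsum abs_summable_summable[OF col])
    qed
    moreover have "((\<lambda>x. \<Sum>z\<in>conj_class G g. M (inv z \<otimes> x) y) has_sum (\<Sum>z\<in>conj_class G g. B y)) ?G \<longleftrightarrow>
        ((\<lambda>x. \<Sum>z\<in>conj_class G g. M x (inv z \<otimes> y)) has_sum (\<Sum>z\<in>conj_class G g. B y)) ?G"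
      by (rule has_sum_cong) (rule invariant[OF g _ y])
    ultimately have "(\<Sum>z\<in>conj_class G g. B y) = (\<Sum>z\<in>conj_class G g. B (inv z \<otimes> y))"
      by (metis has_sum_unique)
    then show ?thesis by simp
  qed
  have B_zero: "B y = 0" if y: "y \<in> ?G" for y
  proof (rule ccontr)
    assume "B y \<noteq> 0"
    then have pos: "norm (B y) > 0" by simp
    \<comment> \<open>With \<open>n\<close> beyond this quotient, a class of more than
      \<open>n\<close> elements gives a contradiction: the points \<open>inv z \<otimes> y\<close>
      are distinct, so the sum of \<open>norm (B w)\<close> over them is at most the total, while by
      \<open>B_class\<close> it is at least the class size times \<open>norm (B y)\<close>.\<close>
    obtain n where n: "(\<Sum>\<^sub>\<infinity>y\<in>?G. norm (B y)) / norm (B y) < real n"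
      using reals_Archimedean2 by blast
    obtain g where g: "g \<in> ?G" "n < card (conj_class G g)"
      using large_class by blast
    note C = subsetD[OF conj_class_subset[OF g(1)]]
    have inj: "inj_on (\<lambda>z. inv z \<otimes> y) (conj_class G g)"
      using C y by (auto intro!: inj_onI)
    have "real (card (conj_class G g)) * norm (B y) = norm (of_nat (card (conj_class G g)) * B y)"
      by (simp add: norm_mult)
    also have "\<dots> \<le> (\<Sum>z\<in>conj_class G g. norm (B (inv z \<otimes> y)))"
      unfolding B_class[OF g(1) y] by (rule norm_sum)
    also have "\<dots> = (\<Sum>w\<in>(\<lambda>z. inv z \<otimes> y) ` conj_class G g. norm (B w))"
      by (simp add: sum.reindex[OF inj])
    also have "\<dots> \<le> (\<Sum>\<^sub>\<infinity>y\<in>?G. norm (B y))"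
      by (rule finite_sum_le_infsum[OF B_summable]) (use C y finite_class[OF g(1)] in auto)
    also have "\<dots> < real n * norm (B y)"
      using n pos by (simp add: pos_divide_less_eq)
    finally have "real (card (conj_class G g)) < real n"
      using pos by simp
    with g(2) show False by simp
  qed
  \<comment> \<open>The shear sending \<open>(z, x)\<close> to \<open>(z, inv z \<otimes> x)\<close>
    permutes each row, so absolute summability is kept and the sums below may be exchanged.\<close>
  have N: "(\<lambda>p. norm (case p of (z, x) \<Rightarrow> M z (inv z \<otimes> x))) summable_on ?G \<times> ?G"
  proof (subst Infinite_Sum.abs_summable_on_Sigma_iff, intro conjI ballI)
    note M' = M[THEN Infinite_Sum.abs_summable_on_Sigma_iff[THEN iffD1]]
    show "(\<lambda>x. norm (case (z, x) of (z, x) \<Rightarrow> M z (inv z \<otimes> x))) summable_on ?G" if "z \<in> ?G" for z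
      using M' that summable_on_reindex_bij_betw[OF bij_betw_shift[OF that], of "\<lambda>x. norm (M z x)"]
      by simp
    have "(\<lambda>z. norm (\<Sum>\<^sub>\<infinity>x\<in>?G. norm (case (z, x) of (z, x) \<Rightarrow> M z (inv z \<otimes> x)))) summable_on ?G \<longleftrightarrow>
        (\<lambda>z. norm (\<Sum>\<^sub>\<infinity>y\<in>?G. norm (case (z, y) of (x, y) \<Rightarrow> M x y))) summable_on ?G"
      by (rule summable_on_cong)
        (simp add: infsum_reindex_bij_betw[OF bij_betw_shift, of _ "\<lambda>x. norm (M z x)" for z])
    then show "(\<lambda>z. norm (\<Sum>\<^sub>\<infinity>x\<in>?G. norm (case (z, x) of (z, x) \<Rightarrow> M z (inv z \<otimes> x)))) summable_on ?G"
      using M' by simp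
  qed
  \<comment> \<open>The total mass is computed first along the fibres of the group multiplication,
    where it is 1, and then along columns, where it is 0.\<close>
  have "(1 :: complex) = (\<Sum>\<^sub>\<infinity>x\<in>?G. if x = \<one> then 1 else 0)"
    by (intro infsumI[symmetric] has_sum_finite_neutralI[where B = "{\<one>}"]) auto
  also have "\<dots> = (\<Sum>\<^sub>\<infinity>x\<in>?G. \<Sum>\<^sub>\<infinity>z\<in>?G. M z (inv z \<otimes> x))"
    by (rule infsum_cong) (simp add: diagonal)
  also have "\<dots> = (\<Sum>\<^sub>\<infinity>z\<in>?G. \<Sum>\<^sub>\<infinity>x\<in>?G. M z (inv z \<otimes> x))"
    by (rule infsum_swap_banach[where f = "\<lambda>z x. M z (inv z \<otimes> x)", OF abs_summable_summable[OF N], symmetric])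
  also have "\<dots> = (\<Sum>\<^sub>\<infinity>z\<in>?G. \<Sum>\<^sub>\<infinity>y\<in>?G. M z y)"
    by (rule infsum_cong) (rule infsum_reindex_bij_betw[OF bij_betw_shift])
  also have "\<dots> = (\<Sum>\<^sub>\<infinity>y\<in>?G. B y)"
    unfolding B_def by (rule infsum_swap_banach[where f = M, OF abs_summable_summable[OF M]])
  also have "\<dots> = 0"
    using B_zero by (simp cong: infsum_cong)
  finally show False by simp
qed

section \<open>Evaluation forms and convolution forms\<close>

abbreviation unit_l1 :: "'a \<Rightarrow> complex" where
  "unit_l1 \<equiv> (\<lambda>x. if x = \<one> then 1 else 0)"

lemma unit_center: "unit_l1 \<in> carrier ZL1"
proof -
  have "t \<otimes> x \<otimes> inv t = \<one> \<longleftrightarrow> x = \<one>" if "t \<in> carrier G" "x \<in> carrier G" for t x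
    using that by (metis inv_solve_right l_cancel_one m_closed one_closed r_one l_one)
  then show ?thesis
    using delta_l1[OF one_closed] by (simp add: center_carrier)
qed

lemma unit_mult:
  assumes "a \<in> carrier ZL1"
  shows "unit_l1 \<otimes>\<^bsub>ZL1\<^esub> a = a" "a \<otimes>\<^bsub>ZL1\<^esub> unit_l1 = a"
proof -
  have "unit_l1 \<otimes>\<^bsub>L1\<^esub> a = a"
  proof
    fix x
    show "(unit_l1 \<otimes>\<^bsub>L1\<^esub> a) x = a x"
    proof (cases "x \<in> carrier G")
      case True
      have "((\<lambda>y. unit_l1 y * a (inv y \<otimes> x)) has_sum a x) (carrier G)"
        by (rule has_sum_finite_neutralI[where B = "{\<one>}"]) (use True in auto)
      from infsumI[OF this] show ?thesis using True by (simp add: l1_mult)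
    next
      case False
      then show ?thesis using center_l1[OF assms] by (simp add: l1_mult l1_carrier)
    qed
  qed
  then show "unit_l1 \<otimes>\<^bsub>ZL1\<^esub> a = a" "a \<otimes>\<^bsub>ZL1\<^esub> unit_l1 = a"
    using center_commute[OF assms center_l1[OF unit_center]] by auto
qed

lemma class_indicator_center:
  assumes g: "g \<in> carrier G"
  shows "indicator (conj_class G g) \<in> carrier ZL1"
proof -
  have "t \<otimes> x \<otimes> inv t \<in> conj_class G g \<longleftrightarrow> x \<in> conj_class G g"
    if t: "t \<in> carrier G" and x: "x \<in> carrier G" for t x
  proof
    assume "t \<otimes> x \<otimes> inv t \<in> conj_class G g"
    from conj_class_closed[OF g inv_closed[OF t] this] show "x \<in> conj_class G g"
      using t x by (simp add: m_assoc) (simp add: m_assoc[symmetric])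
  qed (rule conj_class_closed[OF g t])
  moreover have "(\<lambda>x. cmod (indicator (conj_class G g) x)) summable_on carrier G"
    by (rule finite_nonzero_values_imp_summable_on)
      (use finite_class[OF g] in \<open>auto simp: indicator_def intro: finite_subset\<close>)
  ultimately show ?thesis
    using conj_class_subset[OF g] by (auto simp: center_carrier l1_carrier indicator_def)
qed

lemma class_indicator_mult:
  assumes g: "g \<in> carrier G" and x: "x \<in> carrier G"
  shows "(indicator (conj_class G g) \<otimes>\<^bsub>L1\<^esub> a) x = (\<Sum>z\<in>conj_class G g. a (inv z \<otimes> x))"
proof -
  have "((\<lambda>y. indicator (conj_class G g) y * a (inv y \<otimes> x)) has_sum
      (\<Sum>z\<in>conj_class G g. a (inv z \<otimes> x))) (carrier G)"
    using finite_class[OF g] conj_class_subset[OF g]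
    by (intro has_sum_finite_neutralI[where B = "conj_class G g"]) auto
  from infsumI[OF this] show ?thesis using x by (simp add: l1_mult)
qed

definition ev :: "'a \<Rightarrow> 'a \<Rightarrow> ('a \<Rightarrow> complex) \<times> ('a \<Rightarrow> complex) \<Rightarrow> complex" where
  "ev x y = form_of ZL1 (\<lambda>a b. a x * b y)"

definition conv_form :: "'a \<Rightarrow> ('a \<Rightarrow> complex) \<times> ('a \<Rightarrow> complex) \<Rightarrow> complex" where
  "conv_form x = form_of ZL1 (\<lambda>a b. (a \<otimes>\<^bsub>L1\<^esub> b) x)"

text \<open>A bounded functional \<open>m\<close> on this closed span is determined by its kernel
  \<open>m (ev x y)\<close>, which is why the argument is confined to it.\<close>

definition ev_forms :: "(('a \<Rightarrow> complex) \<times> ('a \<Rightarrow> complex) \<Rightarrow> complex) set" where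
  "ev_forms = closed_form_span ZL1 {ev x y |x y. x \<in> carrier G \<and> y \<in> carrier G}"

lemma ev_apply [simp]: "a \<in> carrier ZL1 \<Longrightarrow> b \<in> carrier ZL1 \<Longrightarrow> ev x y (a, b) = a x * b y"
  by (simp add: ev_def)

lemma ev_outside: "p \<notin> carrier ZL1 \<times> carrier ZL1 \<Longrightarrow> ev x y p = 0"
  unfolding ev_def by (rule form_of_outside)

lemma ev_bilinear: "ev x y \<in> bilinear_forms ZL1"
proof -
  have "form_bound ZL1 (ev x y) 1"
    unfolding form_bound_def
    using l1_eval_le[OF center_l1] l1_nonneg
    by (auto simp: norm_mult simp del: l1_simps intro!: mult_mono)
  moreover note pointwise_spaceD(5,6)[OF pointwise_center]
  ultimately show ?thesis
    unfolding bilinear_forms_def by (auto simp: ev_outside distrib_left distrib_right)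
qed

lemma ev_mem: "x \<in> carrier G \<Longrightarrow> y \<in> carrier G \<Longrightarrow> ev x y \<in> ev_forms"
  unfolding ev_forms_def by (intro closed_form_span.base) blast

lemma closed_ev_forms: "closed_form_space ZL1 ev_forms"
  unfolding ev_forms_def by (rule ZL.closed_form_space_span) (auto intro: ev_bilinear)

lemmas ev_formsD = ZL.closed_form_spaceD[OF closed_ev_forms]

lemma ev_forms_sum:
  "finite F \<Longrightarrow> (\<And>i. i \<in> F \<Longrightarrow> \<Psi> i \<in> ev_forms) \<Longrightarrow> (\<lambda>p. \<Sum>i\<in>F. \<Psi> i p) \<in> ev_forms"
  unfolding ev_forms_def by (rule closed_form_span_sum)

lemma l1_conv_approx:
  assumes "f \<in> carrier L1" "g \<in> carrier L1" "x \<in> carrier G" and Z: "finite Z" "Z \<subseteq> carrier G"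
    and k: "k summable_on carrier G - Z"
      "\<And>y. y \<in> carrier G - Z \<Longrightarrow> cmod (f y * g (inv y \<otimes> x)) \<le> k y"
  shows "cmod ((f \<otimes>\<^bsub>L1\<^esub> g) x - (\<Sum>y\<in>Z. f y * g (inv y \<otimes> x))) \<le> infsum k (carrier G - Z)"
  using infsum_diff_finite_le[OF abs_summable_summable[OF l1_conv_summable[OF assms(1,2)]] Z k]
    assms(3) by (simp add: l1_mult)

text \<open>The set \<open>Z\<close> is read off from the tail of \<open>c\<close> alone, so it
  serves all \<open>a\<close> at once; an estimate by \<open>form_bound\<close> demands this
  uniformity.\<close>

lemma l1_conv_finite_approx:
  assumes c: "c \<in> carrier L1" and x: "x \<in> carrier G" and e: "e > 0"
  obtains Z where "finite Z" "Z \<subseteq> carrier G"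
    "\<And>a. a \<in> carrier L1 \<Longrightarrow>
      cmod ((c \<otimes>\<^bsub>L1\<^esub> a) x - (\<Sum>z\<in>Z. c z * a (inv z \<otimes> x))) \<le> e * vnorm L1 a"
proof -
  have s: "(\<lambda>z. cmod (c z)) summable_on carrier G" using c by (simp add: l1_carrier)
  obtain Z where Z: "finite Z" "Z \<subseteq> carrier G" "infsum (\<lambda>z. cmod (c z)) (carrier G - Z) < e"
    by (rule summable_on_tail[OF s e])
  have "cmod ((c \<otimes>\<^bsub>L1\<^esub> a) x - (\<Sum>z\<in>Z. c z * a (inv z \<otimes> x))) \<le> e * vnorm L1 a"
    if a: "a \<in> carrier L1" for a
  proof -
    have "cmod ((c \<otimes>\<^bsub>L1\<^esub> a) x - (\<Sum>z\<in>Z. c z * a (inv z \<otimes> x)))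
        \<le> infsum (\<lambda>z. cmod (c z) * vnorm L1 a) (carrier G - Z)"
    proof (rule l1_conv_approx[OF c a x Z(1,2)])
      show "(\<lambda>z. cmod (c z) * vnorm L1 a) summable_on carrier G - Z"
        by (intro summable_on_cmult_left summable_on_subset[OF s]) auto
      show "cmod (c y * a (inv y \<otimes> x)) \<le> cmod (c y) * vnorm L1 a" for y
        unfolding norm_mult by (intro mult_left_mono l1_eval_le a) auto
    qed
    also have "\<dots> = infsum (\<lambda>z. cmod (c z)) (carrier G - Z) * vnorm L1 a"
      by (rule infsum_cmult_left')
    also have "\<dots> \<le> e * vnorm L1 a"
      by (rule mult_right_mono) (use Z(3) l1_nonneg in auto)
    finally show ?thesis .
  qed
  with Z(1,2) show ?thesis by (rule that)
qed

text \<open>Multiplying by \<open>c\<close> replaces evaluation at \<open>x\<close> by a series of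
  evaluations at \<open>inv z \<otimes> x\<close> with the summable coefficients \<open>c z\<close>,
  whose truncations converge in the norm of forms.\<close>

lemma ev_left_mem:
  assumes c: "c \<in> carrier ZL1" and x: "x \<in> carrier G" and y: "y \<in> carrier G"
  shows "form_of ZL1 (\<lambda>a b. ev x y (c \<otimes>\<^bsub>ZL1\<^esub> a, b)) \<in> ev_forms"
proof (rule ev_formsD(5)[OF ZL.bilinear_forms_left[OF ev_bilinear c]])
  fix e :: real assume e: "e > 0"
  obtain Z where Z: "finite Z" "Z \<subseteq> carrier G"
    "\<And>a. a \<in> carrier L1 \<Longrightarrow>
      cmod ((c \<otimes>\<^bsub>L1\<^esub> a) x - (\<Sum>z\<in>Z. c z * a (inv z \<otimes> x))) \<le> e * vnorm L1 a"
    using l1_conv_finite_approx[OF center_l1[OF c] x e] by blast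
  let ?\<Phi> = "\<lambda>p. \<Sum>z\<in>Z. c z * ev (inv z \<otimes> x) y p"
  have bound: "form_bound ZL1 (\<lambda>p. form_of ZL1 (\<lambda>a b. ev x y (c \<otimes>\<^bsub>ZL1\<^esub> a, b)) p - ?\<Phi> p) e"
    unfolding form_bound_def
  proof (intro ballI)
    fix a b assume a: "a \<in> carrier ZL1" and b: "b \<in> carrier ZL1"
    have "form_of ZL1 (\<lambda>a b. ev x y (c \<otimes>\<^bsub>ZL1\<^esub> a, b)) (a, b) - ?\<Phi> (a, b) =
        ((c \<otimes>\<^bsub>L1\<^esub> a) x - (\<Sum>z\<in>Z. c z * a (inv z \<otimes> x))) * b y"
      using a b center_mult_closed[OF c a] by (simp add: left_diff_distrib sum_distrib_right mult.assoc)
    also have "cmod \<dots> \<le> (e * vnorm L1 a) * vnorm L1 b"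
      unfolding norm_mult using e
      by (intro mult_mono Z(3) l1_eval_le center_l1 a b mult_nonneg_nonneg l1_nonneg) auto
    finally show "cmod (form_of ZL1 (\<lambda>a b. ev x y (c \<otimes>\<^bsub>ZL1\<^esub> a, b)) (a, b) - ?\<Phi> (a, b))
        \<le> e * (vnorm ZL1 a * vnorm ZL1 b)"
      by (simp add: mult.assoc)
  qed
  have "?\<Phi> \<in> ev_forms"
    using Z(1,2) x y by (intro ev_forms_sum ev_formsD(4) ev_mem) auto
  then show "\<exists>\<Phi>\<in>ev_forms. form_bound ZL1
      (\<lambda>p. form_of ZL1 (\<lambda>a b. ev x y (c \<otimes>\<^bsub>ZL1\<^esub> a, b)) p - \<Phi> p) e"
    by (rule bexI[rotated]) (rule bound)
qed

lemma ev_right_mem: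
  assumes c: "c \<in> carrier ZL1" and x: "x \<in> carrier G" and y: "y \<in> carrier G"
  shows "form_of ZL1 (\<lambda>a b. ev x y (a, b \<otimes>\<^bsub>ZL1\<^esub> c)) \<in> ev_forms"
proof (rule ev_formsD(5)[OF ZL.bilinear_forms_right[OF ev_bilinear c]])
  fix e :: real assume e: "e > 0"
  obtain Z where Z: "finite Z" "Z \<subseteq> carrier G"
    "\<And>a. a \<in> carrier L1 \<Longrightarrow>
      cmod ((c \<otimes>\<^bsub>L1\<^esub> a) y - (\<Sum>z\<in>Z. c z * a (inv z \<otimes> y))) \<le> e * vnorm L1 a"
    using l1_conv_finite_approx[OF center_l1[OF c] y e] by blast
  let ?\<Phi> = "\<lambda>p. \<Sum>z\<in>Z. c z * ev x (inv z \<otimes> y) p"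
  have bound: "form_bound ZL1 (\<lambda>p. form_of ZL1 (\<lambda>a b. ev x y (a, b \<otimes>\<^bsub>ZL1\<^esub> c)) p - ?\<Phi> p) e"
    unfolding form_bound_def
  proof (intro ballI)
    fix a b assume a: "a \<in> carrier ZL1" and b: "b \<in> carrier ZL1"
    \<comment> \<open>Centrality turns the product of \<open>b\<close> and \<open>c\<close> into
      that of \<open>c\<close> and \<open>b\<close>, to which the truncation applies.\<close>
    have "form_of ZL1 (\<lambda>a b. ev x y (a, b \<otimes>\<^bsub>ZL1\<^esub> c)) (a, b) - ?\<Phi> (a, b) =
        a x * ((c \<otimes>\<^bsub>L1\<^esub> b) y - (\<Sum>z\<in>Z. c z * b (inv z \<otimes> y)))"
      using a b center_mult_closed[OF c b] center_commute[OF b center_l1[OF c]]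
      by (simp add: right_diff_distrib sum_distrib_left mult.left_commute)
    also have "cmod \<dots> \<le> vnorm L1 a * (e * vnorm L1 b)"
      unfolding norm_mult using e
      by (intro mult_mono Z(3) l1_eval_le center_l1 a b mult_nonneg_nonneg l1_nonneg) auto
    finally show "cmod (form_of ZL1 (\<lambda>a b. ev x y (a, b \<otimes>\<^bsub>ZL1\<^esub> c)) (a, b) - ?\<Phi> (a, b))
        \<le> e * (vnorm ZL1 a * vnorm ZL1 b)"
      by (simp add: mult.left_commute)
  qed
  have "?\<Phi> \<in> ev_forms"
    using Z(1,2) x y by (intro ev_forms_sum ev_formsD(4) ev_mem) auto
  then show "\<exists>\<Phi>\<in>ev_forms. form_bound ZL1
      (\<lambda>p. form_of ZL1 (\<lambda>a b. ev x y (a, b \<otimes>\<^bsub>ZL1\<^esub> c)) p - \<Phi> p) e"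
    by (rule bexI[rotated]) (rule bound)
qed

lemma conv_form_outside: "p \<notin> carrier ZL1 \<times> carrier ZL1 \<Longrightarrow> conv_form x p = 0"
  unfolding conv_form_def by (rule form_of_outside)

text \<open>Only the value of \<open>c\<close> at \<open>y\<close> is seen. The third kind of
  stability thus rests on membership of \<open>conv_form x\<close>, and there the class sizes
  enter.\<close>

lemma ev_mid:
  assumes c: "c \<in> carrier ZL1"
  shows "form_of ZL1 (\<lambda>a b. ev x y (a \<otimes>\<^bsub>ZL1\<^esub> b, c)) = (\<lambda>p. c y * conv_form x p)"
  by (rule form_eqI[of ZL1])
    (use c in \<open>simp_all add: form_of_outside conv_form_outside, simp add: conv_form_def center_mult_closed\<close>)

text \<open>At \<one> the unit has value 1, so the scalar in \<open>ev_mid\<close> disappears. This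
  shape shows that the convolution form is bilinear and matches the diagonal property in
  \<open>amenable_functional\<close>.\<close>

lemma conv_form_eq: "conv_form x = form_of ZL1 (\<lambda>a b. ev x \<one> (a \<otimes>\<^bsub>ZL1\<^esub> b, unit_l1))"
  unfolding ev_mid[OF unit_center] by simp

text \<open>The convolution form is a uniform limit of finite sums of evaluations because a class
  function is small off the finitely many small classes.\<close>

lemma conv_form_approx:
  assumes x: "x \<in> carrier G" and e: "e > 0"
  obtains Z0 where "finite Z0" "Z0 \<subseteq> carrier G"
    "\<forall>Z. finite Z \<and> Z0 \<subseteq> Z \<and> Z \<subseteq> carrier G \<longrightarrow>
      form_bound ZL1 (\<lambda>p. conv_form x p - (\<Sum>z\<in>Z. ev z (inv z \<otimes> x) p)) e"
proof -
  obtain n where n: "inverse (real (Suc n)) < e"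
    using reals_Archimedean[OF e] by blast
  \<comment> \<open>Off \<open>Z0\<close> the second factor of the convolution is evaluated in a
    class of more than \<open>n\<close> elements. The set is finite because \<open>z\<close> is
    recovered from \<open>w = inv z \<otimes> x\<close> as \<open>x \<otimes> inv w\<close>.\<close>
  define Z0 where "Z0 = {z \<in> carrier G. card (conj_class G (inv z \<otimes> x)) \<le> n}"
  have "Z0 \<subseteq> (\<lambda>w. x \<otimes> inv w) ` {w \<in> carrier G. card (conj_class G w) \<le> n}"
  proof
    fix z assume z: "z \<in> Z0"
    then have "x \<otimes> inv (inv z \<otimes> x) = z"
      using x by (simp add: Z0_def inv_mult_group m_assoc[symmetric])
    with z show "z \<in> (\<lambda>w. x \<otimes> inv w) ` {w \<in> carrier G. card (conj_class G w) \<le> n}"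
      using x by (intro image_eqI[of _ _ "inv z \<otimes> x"]) (auto simp: Z0_def)
  qed
  then have fin: "finite Z0"
    by (rule finite_subset) (intro finite_imageI finite_small_classes)
  \<comment> \<open>Admitting every finite set above \<open>Z0\<close> is what later gives
    convergence along all finite subsets of the group.\<close>
  have bound: "form_bound ZL1 (\<lambda>p. conv_form x p - (\<Sum>z\<in>Z. ev z (inv z \<otimes> x) p)) e"
    if Z: "finite Z" "Z0 \<subseteq> Z" "Z \<subseteq> carrier G" for Z
    unfolding form_bound_def
  proof (intro ballI)
    fix a b assume a: "a \<in> carrier ZL1" and b: "b \<in> carrier ZL1"
    define t where "t = vnorm L1 b * inverse (real (Suc n))"
    have t: "0 \<le> t" unfolding t_def by (intro mult_nonneg_nonneg l1_nonneg) auto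
    have s: "(\<lambda>z. cmod (a z) * t) summable_on carrier G"
      using center_l1[OF a] by (intro summable_on_cmult_left) (simp add: l1_carrier)
    have "cmod ((a \<otimes>\<^bsub>L1\<^esub> b) x - (\<Sum>z\<in>Z. a z * b (inv z \<otimes> x)))
        \<le> infsum (\<lambda>z. cmod (a z) * t) (carrier G - Z)"
    proof (rule l1_conv_approx[OF center_l1[OF a] center_l1[OF b] x Z(1,3)])
      show "(\<lambda>z. cmod (a z) * t) summable_on carrier G - Z"
        by (rule summable_on_subset[OF s]) auto
      fix y assume "y \<in> carrier G - Z"
      then have "n < card (conj_class G (inv y \<otimes> x))" "inv y \<otimes> x \<in> carrier G"
        using Z(2) x by (auto simp: Z0_def not_le)
      then have "cmod (b (inv y \<otimes> x)) \<le> t"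
        unfolding t_def by (intro class_function_small b)
      then show "cmod (a y * b (inv y \<otimes> x)) \<le> cmod (a y) * t"
        unfolding norm_mult by (intro mult_left_mono) auto
    qed
    also have "\<dots> \<le> infsum (\<lambda>z. cmod (a z) * t) (carrier G)"
      by (rule infsum_mono2[OF summable_on_subset[OF s] s]) (use t in auto)
    also have "\<dots> = vnorm L1 a * t" by (simp add: infsum_cmult_left')
    also have "\<dots> = inverse (real (Suc n)) * (vnorm L1 a * vnorm L1 b)"
      by (simp add: t_def)
    also have "\<dots> \<le> e * (vnorm L1 a * vnorm L1 b)"
      using n by (intro mult_right_mono mult_nonneg_nonneg l1_nonneg) auto
    finally show "cmod (conv_form x (a, b) - (\<Sum>z\<in>Z. ev z (inv z \<otimes> x) (a, b)))
        \<le> e * (vnorm ZL1 a * vnorm ZL1 b)"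
      using a b by (simp add: conv_form_def del: l1_simps)
  qed
  have "Z0 \<subseteq> carrier G" by (auto simp: Z0_def)
  with that fin bound show ?thesis by blast
qed

lemma conv_form_bilinear: "conv_form x \<in> bilinear_forms ZL1"
  unfolding conv_form_eq by (rule ZL.bilinear_forms_mid[OF ev_bilinear unit_center])

lemma conv_form_mem:
  assumes x: "x \<in> carrier G"
  shows "conv_form x \<in> ev_forms"
proof (rule ev_formsD(5)[OF conv_form_bilinear])
  fix e :: real assume e: "e > 0"
  obtain Z where Z: "finite Z" "Z \<subseteq> carrier G"
    and bound: "\<forall>Z'. finite Z' \<and> Z \<subseteq> Z' \<and> Z' \<subseteq> carrier G \<longrightarrow>
      form_bound ZL1 (\<lambda>p. conv_form x p - (\<Sum>z\<in>Z'. ev z (inv z \<otimes> x) p)) e"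
    by (rule conv_form_approx[OF x e])
  have "(\<lambda>p. \<Sum>z\<in>Z. ev z (inv z \<otimes> x) p) \<in> ev_forms"
    using Z(1,2) x by (intro ev_forms_sum ev_mem) auto
  then show "\<exists>\<Phi>\<in>ev_forms. form_bound ZL1 (\<lambda>p. conv_form x p - \<Phi> p) e"
    by (rule bexI[rotated]) (use bound Z in blast)
qed

text \<open>It suffices to treat evaluations. The outer multiplications are truncated along the tail
  of \<open>c\<close>; the inner one collapses to a multiple of a convolution form.\<close>

lemma ev_forms_stable:
  assumes "\<Psi> \<in> ev_forms" "c \<in> carrier ZL1"
  shows "form_of ZL1 (\<lambda>a b. \<Psi> (c \<otimes>\<^bsub>ZL1\<^esub> a, b)) \<in> ev_forms"
    "form_of ZL1 (\<lambda>a b. \<Psi> (a, b \<otimes>\<^bsub>ZL1\<^esub> c)) \<in> ev_forms"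
    "form_of ZL1 (\<lambda>a b. \<Psi> (a \<otimes>\<^bsub>ZL1\<^esub> b, c)) \<in> ev_forms"
proof -
  let ?X = "{ev x y |x y. x \<in> carrier G \<and> y \<in> carrier G}"
  have X: "\<exists>x\<in>carrier G. \<exists>y\<in>carrier G. \<Phi> = ev x y" if "\<Phi> \<in> ?X" for \<Phi>
    using that by blast
  show "form_of ZL1 (\<lambda>a b. \<Psi> (c \<otimes>\<^bsub>ZL1\<^esub> a, b)) \<in> ev_forms"
    unfolding ev_forms_def
  proof (rule ZL.closed_form_span_left[OF _ assms(2) assms(1)[unfolded ev_forms_def]])
    fix \<Phi> assume "\<Phi> \<in> ?X"
    then obtain x y where "x \<in> carrier G" "y \<in> carrier G" "\<Phi> = ev x y" using X by blast
    then show "form_of ZL1 (\<lambda>a b. \<Phi> (c \<otimes>\<^bsub>ZL1\<^esub> a, b)) \<in> closed_form_span ZL1 ?X"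
      using ev_left_mem[OF assms(2), of x y] by (simp only: ev_forms_def)
  qed
  show "form_of ZL1 (\<lambda>a b. \<Psi> (a, b \<otimes>\<^bsub>ZL1\<^esub> c)) \<in> ev_forms"
    unfolding ev_forms_def
  proof (rule ZL.closed_form_span_right[OF _ assms(2) assms(1)[unfolded ev_forms_def]])
    fix \<Phi> assume "\<Phi> \<in> ?X"
    then obtain x y where "x \<in> carrier G" "y \<in> carrier G" "\<Phi> = ev x y" using X by blast
    then show "form_of ZL1 (\<lambda>a b. \<Phi> (a, b \<otimes>\<^bsub>ZL1\<^esub> c)) \<in> closed_form_span ZL1 ?X"
      using ev_right_mem[OF assms(2), of x y] by (simp only: ev_forms_def)
  qed
  show "form_of ZL1 (\<lambda>a b. \<Psi> (a \<otimes>\<^bsub>ZL1\<^esub> b, c)) \<in> ev_forms"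
    unfolding ev_forms_def
  proof (rule ZL.closed_form_span_mid[OF _ assms(2) assms(1)[unfolded ev_forms_def]])
    fix \<Phi> assume "\<Phi> \<in> ?X"
    then obtain x y where xy: "x \<in> carrier G" "y \<in> carrier G" "\<Phi> = ev x y" using X by blast
    show "form_of ZL1 (\<lambda>a b. \<Phi> (a \<otimes>\<^bsub>ZL1\<^esub> b, c)) \<in> closed_form_span ZL1 ?X"
      unfolding xy(3) ev_mid[OF assms(2)]
      using ev_formsD(4)[OF conv_form_mem[OF xy(1)], of "c y"] by (simp only: ev_forms_def)
  qed
qed

text \<open>This is the duality of c_0 and l^1. A finite combination of evaluations with
  coefficients of modulus at most 1 has form norm at most 1, and suitable phases turn its image
  under \<open>m\<close> into the sum of the absolute values of the kernel.\<close>

lemma functional_kernel_summable: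
  assumes scale: "\<And>z \<Psi>. \<Psi> \<in> ev_forms \<Longrightarrow> m (\<lambda>p. z * \<Psi> p) = z * m \<Psi>"
    and K: "\<And>\<Psi>. \<Psi> \<in> ev_forms \<Longrightarrow> cmod (m \<Psi>) \<le> K * form_norm ZL1 \<Psi>"
    and sum: "\<And>(F :: ('a \<times> 'a) set) \<Psi>. finite F \<Longrightarrow> (\<And>i. i \<in> F \<Longrightarrow> \<Psi> i \<in> ev_forms) \<Longrightarrow>
      m (\<lambda>p. \<Sum>i\<in>F. \<Psi> i p) = (\<Sum>i\<in>F. m (\<Psi> i))"
  shows "(\<lambda>q. norm (case q of (x, y) \<Rightarrow> m (ev x y))) summable_on carrier G \<times> carrier G"
proof (rule summable_on_nonneg_bounded(1))
  fix F assume F: "finite F" "F \<subseteq> carrier G \<times> carrier G"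
  define M where "M q = m (ev (fst q) (snd q))" for q
  define u where "u q = (if M q = 0 then 0 else of_real (cmod (M q)) / M q)" for q
  have u: "u q * M q = of_real (cmod (M q))" "cmod (u q) \<le> 1" for q
    by (auto simp: u_def norm_divide)
  let ?\<Phi> = "\<lambda>p. \<Sum>q\<in>F. u q * ev (fst q) (snd q) p"
  have ev: "ev (fst q) (snd q) \<in> ev_forms" if "q \<in> F" for q
    using that F(2) by (intro ev_mem) auto
  have "form_bound ZL1 ?\<Phi> 1"
    unfolding form_bound_def
  proof (intro ballI)
    fix a b assume a: "a \<in> carrier ZL1" and b: "b \<in> carrier ZL1"
    have "cmod (?\<Phi> (a, b)) \<le> (\<Sum>q\<in>F. cmod (a (fst q)) * cmod (b (snd q)))"
    proof (rule sum_norm_le)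
      fix q assume "q \<in> F"
      have "cmod (u q) * cmod (a (fst q) * b (snd q)) \<le> 1 * cmod (a (fst q) * b (snd q))"
        by (rule mult_right_mono[OF u(2)]) simp
      then show "norm (u q * ev (fst q) (snd q) (a, b)) \<le> cmod (a (fst q)) * cmod (b (snd q))"
        using a b by (simp add: norm_mult)
    qed
    \<comment> \<open>Enlarging \<open>F\<close> to the product of its two projections makes the
      double sum factor into partial sums of the two norms.\<close>
    also have "\<dots> \<le> (\<Sum>q\<in>fst ` F \<times> snd ` F. cmod (a (fst q)) * cmod (b (snd q)))"
      using F(1) by (intro sum_mono2 subset_fst_snd) auto
    also have "\<dots> = (\<Sum>x\<in>fst ` F. cmod (a x)) * (\<Sum>y\<in>snd ` F. cmod (b y))"
      by (simp add: sum_product sum.cartesian_product case_prod_unfold)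
    also have "\<dots> \<le> vnorm L1 a * vnorm L1 b"
      using F by (intro mult_mono l1_finite_sum_le center_l1 a b l1_nonneg sum_nonneg) auto
    finally show "cmod (?\<Phi> (a, b)) \<le> 1 * (vnorm ZL1 a * vnorm ZL1 b)" by simp
  qed
  then have \<Phi>_norm: "form_norm ZL1 ?\<Phi> \<le> 1" by (rule ZL.form_norm_le) simp
  have \<Phi>: "?\<Phi> \<in> ev_forms" by (intro ev_forms_sum ev_formsD(4) ev F(1))
  have "m ?\<Phi> = (\<Sum>q\<in>F. m (\<lambda>p. u q * ev (fst q) (snd q) p))"
    by (rule sum[OF F(1)]) (intro ev_formsD(4) ev)
  also have "\<dots> = of_real (\<Sum>q\<in>F. cmod (M q))"
    unfolding of_real_sum using scale[OF ev] u(1) by (intro sum.cong) (auto simp: M_def)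
  finally have "cmod (m ?\<Phi>) = (\<Sum>q\<in>F. cmod (M q))"
    by (simp add: sum_nonneg del: of_real_sum)
  moreover have "cmod (m ?\<Phi>) \<le> \<bar>K\<bar> * form_norm ZL1 ?\<Phi>"
    using K[OF \<Phi>] ZL.form_norm_nonneg[OF ev_formsD(1)[OF \<Phi>]]
    by (meson abs_ge_self mult_right_mono order_trans)
  moreover have "\<bar>K\<bar> * form_norm ZL1 ?\<Phi> \<le> \<bar>K\<bar> * 1"
    by (rule mult_left_mono[OF \<Phi>_norm]) simp
  ultimately show "(\<Sum>q\<in>F. norm (case q of (x, y) \<Rightarrow> m (ev x y))) \<le> \<bar>K\<bar>"
    by (simp add: M_def case_prod_unfold)
qed simp

theorem not_amenable_center: "\<not> amenable ZL1"
proof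
  assume amen: "amenable ZL1"
  obtain m K where add: "\<And>\<Psi> \<Phi>. \<Psi> \<in> ev_forms \<Longrightarrow> \<Phi> \<in> ev_forms \<Longrightarrow> m (\<lambda>p. \<Psi> p + \<Phi> p) = m \<Psi> + m \<Phi>"
    and scale: "\<And>z \<Psi>. \<Psi> \<in> ev_forms \<Longrightarrow> m (\<lambda>p. z * \<Psi> p) = z * m \<Psi>"
    and K: "\<And>\<Psi>. \<Psi> \<in> ev_forms \<Longrightarrow> cmod (m \<Psi>) \<le> K * form_norm ZL1 \<Psi>"
    and unit: "\<And>\<Psi>. \<Psi> \<in> ev_forms \<Longrightarrow>
       m (form_of ZL1 (\<lambda>a b. \<Psi> (a \<otimes>\<^bsub>ZL1\<^esub> b, unit_l1))) = \<Psi> (unit_l1, unit_l1)"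
    and inner: "\<And>\<Psi> c. \<Psi> \<in> ev_forms \<Longrightarrow> c \<in> carrier ZL1 \<Longrightarrow>
       m (form_of ZL1 (\<lambda>a b. \<Psi> (c \<otimes>\<^bsub>ZL1\<^esub> a, b))) - m (form_of ZL1 (\<lambda>a b. \<Psi> (a, b \<otimes>\<^bsub>ZL1\<^esub> c))) =
       \<Psi> (unit_l1, c) - m (form_of ZL1 (\<lambda>a b. \<Psi> (a \<otimes>\<^bsub>ZL1\<^esub> b, c)))"
    by (rule ZL.amenable_functional[OF amen closed_ev_forms unit_center unit_mult ev_forms_stable]) blast+
  have zero: "m (\<lambda>p. 0) = 0"
    using scale[OF ev_formsD(2), of 0] by simp
  have sum: "m (\<lambda>p. \<Sum>i\<in>F. \<Psi> i p) = (\<Sum>i\<in>F. m (\<Psi> i))"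
    if "finite F" "\<And>i. i \<in> F \<Longrightarrow> \<Psi> i \<in> ev_forms" for F :: "'i set" and \<Psi>
    using that
  proof (induction F)
    case (insert i F)
    have "m (\<lambda>p. \<Psi> i p + (\<Sum>j\<in>F. \<Psi> j p)) = m (\<Psi> i) + m (\<lambda>p. \<Sum>j\<in>F. \<Psi> j p)"
      using insert by (intro add ev_forms_sum) auto
    with insert show ?case by simp
  qed (simp add: zero)
  \<comment> \<open>This is the diagonal property for \<open>ev x \<one>\<close>, whose value at the
    pair of units is \<open>unit_l1 x\<close>.\<close>
  have conv: "m (conv_form x) = unit_l1 x" if x: "x \<in> carrier G" for x
    unfolding conv_form_eq using unit[OF ev_mem[OF x one_closed]] unit_center by simp
  show False
  proof (rule no_diagonal_kernel[where M = "\<lambda>x y. m (ev x y)"])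
    show "(\<lambda>q. norm (case q of (x, y) \<Rightarrow> m (ev x y))) summable_on carrier G \<times> carrier G"
      by (rule functional_kernel_summable[OF scale K sum])
    show "(\<Sum>\<^sub>\<infinity>z\<in>carrier G. m (ev z (inv z \<otimes> x))) = (if x = \<one> then 1 else 0)"
      if x: "x \<in> carrier G" for x
    proof (rule infsumI)
      have "\<forall>\<^sub>F Z in finite_subsets_at_top (carrier G).
          dist (\<Sum>z\<in>Z. m (ev z (inv z \<otimes> x))) (unit_l1 x) < e" if e: "e > 0" for e
      proof -
        \<comment> \<open>The error \<open>d\<close> is magnified by at most
          \<open>\<bar>K\<bar>\<close> under \<open>m\<close>; adding 1 keeps the quotient defined
          for \<open>K = 0\<close>.\<close>
        define d where "d = e / (\<bar>K\<bar> + 1)"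
        have d: "d > 0" "\<bar>K\<bar> * d < e"
          using e by (simp_all add: d_def field_simps)
        obtain Z0 where Z0: "finite Z0" "Z0 \<subseteq> carrier G"
          and bound: "\<forall>Z. finite Z \<and> Z0 \<subseteq> Z \<and> Z \<subseteq> carrier G \<longrightarrow>
      form_bound ZL1 (\<lambda>p. conv_form x p - (\<Sum>z\<in>Z. ev z (inv z \<otimes> x) p)) d"
          by (rule conv_form_approx[OF x d(1)])
        have "dist (\<Sum>z\<in>Z. m (ev z (inv z \<otimes> x))) (unit_l1 x) < e"
          if Z: "finite Z" "Z0 \<subseteq> Z" "Z \<subseteq> carrier G" for Z
        proof -
          let ?S = "\<lambda>p. \<Sum>z\<in>Z. ev z (inv z \<otimes> x) p"
          let ?D = "\<lambda>p. conv_form x p + (-1) * ?S p"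
          have ev: "ev z (inv z \<otimes> x) \<in> ev_forms" if "z \<in> Z" for z
            using that Z(3) x by (intro ev_mem) auto
          have S: "?S \<in> ev_forms" by (rule ev_forms_sum[OF Z(1) ev])
          have D: "?D \<in> ev_forms"
            by (intro ev_formsD(3) ev_formsD(4) conv_form_mem x S)
          have "m ?D = m (conv_form x) + (-1) * m ?S"
            by (simp only: add[OF conv_form_mem[OF x] ev_formsD(4)[OF S]] scale[OF S])
          also have "\<dots> = unit_l1 x - (\<Sum>z\<in>Z. m (ev z (inv z \<otimes> x)))"
            using sum[OF Z(1) ev] conv[OF x] by simp
          finally have "dist (\<Sum>z\<in>Z. m (ev z (inv z \<otimes> x))) (unit_l1 x) = cmod (m ?D)"
            by (simp add: dist_norm norm_minus_commute)
          also have "\<dots> \<le> K * form_norm ZL1 ?D" by (rule K[OF D])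
          also have "\<dots> \<le> \<bar>K\<bar> * form_norm ZL1 ?D"
            by (intro mult_right_mono ZL.form_norm_nonneg ev_formsD(1) D) simp
          also have "\<dots> \<le> \<bar>K\<bar> * d"
            using bound Z d(1) by (intro mult_left_mono ZL.form_norm_le) auto
          finally show ?thesis using d(2) by simp
        qed
        then show ?thesis
          using Z0 by (auto simp: eventually_finite_subsets_at_top intro!: exI[of _ Z0])
      qed
      then show "((\<lambda>z. m (ev z (inv z \<otimes> x))) has_sum (if x = \<one> then 1 else 0)) (carrier G)"
        unfolding has_sum_def tendsto_iff by blast
    qed
    show "(\<Sum>z\<in>conj_class G g. m (ev (inv z \<otimes> x) y)) = (\<Sum>z\<in>conj_class G g. m (ev x (inv z \<otimes> y)))"
      if g: "g \<in> carrier G" and x: "x \<in> carrier G" and y: "y \<in> carrier G" for g x y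
    proof -
      let ?C = "conj_class G g"
      let ?c = "indicator ?C :: 'a \<Rightarrow> complex"
      note C = finite_class[OF g] subsetD[OF conj_class_subset[OF g]]
      note c = class_indicator_center[OF g]
      have left: "form_of ZL1 (\<lambda>a b. ev x y (?c \<otimes>\<^bsub>ZL1\<^esub> a, b)) = (\<lambda>p. \<Sum>z\<in>?C. ev (inv z \<otimes> x) y p)"
        by (rule form_eqI[of ZL1])
          (simp_all add: form_of_outside ev_outside center_mult_closed[OF c] class_indicator_mult[OF g x]
            sum_distrib_right)
      have right: "form_of ZL1 (\<lambda>a b. ev x y (a, b \<otimes>\<^bsub>ZL1\<^esub> ?c)) = (\<lambda>p. \<Sum>z\<in>?C. ev x (inv z \<otimes> y) p)"
        by (rule form_eqI[of ZL1])
          (simp_all add: form_of_outside ev_outside center_commute[OF _ center_l1[OF c]]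
            center_mult_closed[OF c] class_indicator_mult[OF g y] sum_distrib_left)
      \<comment> \<open>Both this term and the evaluation at the unit and \<open>?c\<close> equal
        \<open>?c y * unit_l1 x\<close>, so the right-hand side of \<open>inner\<close> vanishes and
        pure invariance remains.\<close>
      have "m (form_of ZL1 (\<lambda>a b. ev x y (a \<otimes>\<^bsub>ZL1\<^esub> b, ?c))) = ev x y (unit_l1, ?c)"
        unfolding ev_mid[OF c] scale[OF conv_form_mem[OF x]] conv[OF x]
        using unit_center c by simp
      with inner[OF ev_mem[OF x y] c] have "m (\<lambda>p. \<Sum>z\<in>?C. ev (inv z \<otimes> x) y p) =
          m (\<lambda>p. \<Sum>z\<in>?C. ev x (inv z \<otimes> y) p)"
        unfolding left right by simp
      then show ?thesis
        using sum[OF C(1), of "\<lambda>z. ev (inv z \<otimes> x) y"] sum[OF C(1), of "\<lambda>z. ev x (inv z \<otimes> y)"] C(2) x y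
        by (simp add: ev_mem)
    qed
  qed
qed

end

theorem corollary4p5:
  fixes G :: "('g, 'm) monoid_scheme"
  assumes "FC_group G"
    and "infinite (carrier G)"
    and "\<And>n::nat. finite {C \<in> conj_classes G. card C = n}"
  shows "\<not> amenable (algebra_center (l1_algebra G))"
proof -
  interpret group G using assms(1) by (simp add: FC_group_def)
  have finite_class: "finite (conj_class G x)" if "x \<in> carrier G" for x
    using assms(1) that by (auto simp: FC_group_def conj_classes_def)
  have "finite {x \<in> carrier G. card (conj_class G x) \<le> n}" for n
  proof (rule finite_subset)
    \<comment> \<open>The hypothesis counts classes of one exact size. Finitely many sizes give
      finitely many classes, each of them finite, and every element lies in its own class.\<close>
    let ?S = "\<Union>k\<le>n. {C \<in> conj_classes G. card C = k}"
    show "{x \<in> carrier G. card (conj_class G x) \<le> n} \<subseteq> \<Union> ?S"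
    proof
      fix x assume x: "x \<in> {x \<in> carrier G. card (conj_class G x) \<le> n}"
      then have "x \<in> conj_class G x"
        by (auto simp: conj_class_def intro!: image_eqI[of _ _ "\<one>\<^bsub>G\<^esub>"])
      with x show "x \<in> \<Union> ?S" by (auto simp: conj_classes_def)
    qed
    show "finite (\<Union> ?S)"
      using finite_class assms(3) by (intro finite_Union) (auto simp: conj_classes_def)
  qed
  then interpret small_class_group G
    using assms(2) finite_class by unfold_locales
  show ?thesis by (rule not_amenable_center)
qed

end
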